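(* Let $\Sigma$ be a controllable oriented graph on $n$ vertices with skew-walk matrix $W(\Sigma)$, and let $d_n$ be the last invariant factor of $W(\Sigma)$. Suppose that $d_n$ is square-free, that $\operatorname{rank}_2 W(\Sigma)=\lceil n/2\rceil$, and that for every odd prime divisor $p$ of $d_n$: (i) $\deg \operatorname{sfp}(\Phi_p(\Sigma;x))=\operatorname{nullity}_p W(\Sigma)$; (ii) writing $\operatorname{sfp}(\Phi_p(\Sigma;x))=\varphi_1(x)\cdots\varphi_s(x)$ as a product of distinct monic irreducible polynomials over $\mathbb{F}_p$, one has $\gcd(\varphi_i(x),\varphi_j(-x))=1$ in $\mathbb{F}_p[x]$ whenever $i\neq j$. Then $\Sigma$ is self-converse, i.e. $\Sigma$ is isomorphic to its converse $\Sigma^{\mathrm T}$, the oriented graph obtained from $\Sigma$ by reversing the direction of every arc.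
   Context: An oriented graph $\Sigma$ on vertices $v_1,\dots,v_n$ is obtained from a finite simple undirected graph by giving each edge one direction. Its skew-adjacency matrix $S=S(\Sigma)=(s_{ij})$ has $s_{ij}=1$ if $(v_i,v_j)$ is an arc, $s_{ij}=-1$ if $(v_j,v_i)$ is an arc, and $s_{ij}=0$ otherwise; so $S^{\mathrm T}=-S$. Let $e$ be the all-one column vector, $J=ee^{\mathrm T}$ the all-one matrix, and $\chi(M;x)=\det(xI-M)$. The skew-walk matrix is the $n\times n$ integral matrix $W(\Sigma)=[e,Se,\ldots,S^{n-1}e]$; $\Sigma$ is controllable if $W(\Sigma)$ is nonsingular (over $\mathbb{Q}$). The Smith normal form of a nonsingular integral $n\times n$ matrix is the unique diagonal matrix $\operatorname{diag}(d_1,\dots,d_n)$ integrally equivalent to it with positive integers $d_i\mid d_{i+1}$; the $d_i$ are its invariant factors and $d_n$ is the last one. For a prime $p$, $\operatorname{rank}_p M$ and $\operatorname{nullity}_p M$ are the rank and nullity over $\mathbb{F}_p$ of the reduction mod $p$ of an integral matrix $M$. Define $\Phi_p(\Sigma;x)=\gcd(\chi(S;x),\chi(S+J;x))\in\mathbb{F}_p[x]$ (monic gcd of the reductions mod $p$). For a monic $f=\prod_i f_i^{a_i}\in\mathbb{F}_p[x]$ with distinct monic irreducible $f_i$ and $a_i\ge 1$, the square-free part is $\operatorname{sfp}(f)=\prod_i f_i$. *)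

theory Defs
  imports
    "HOL-Number_Theory.Residues"
    "HOL-Computational_Algebra.Squarefree"
    "Jordan_Normal_Form.Char_Poly"
    "Jordan_Normal_Form.VS_Connect"
    "Berlekamp_Zassenhaus.Poly_Mod"
    "Graph_Theory.Graph_Theory"
begin

section \<open>Oriented graphs\<close>

locale oriented_graph = pair_digraph G for G :: "'a pair_pre_digraph" +
  assumes one_direction: "(u, v) \<in> parcs G \<Longrightarrow> (v, u) \<notin> parcs G"

definition converse_graph :: "'a pair_pre_digraph \<Rightarrow> 'a pair_pre_digraph" where
  "converse_graph G = \<lparr>pverts = pverts G, parcs = (parcs G)\<inverse>\<rparr>"

definition self_converse :: "'a pair_pre_digraph \<Rightarrow> bool" where
  "self_converse G \<longleftrightarrow> digraph_iso (with_proj G) (with_proj (converse_graph G))"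


section \<open>Integral matrices attached to an oriented graph\<close>

text \<open>The matrices below are meant for a graph with vertex set \<open>{0..<n}\<close>; the vertex \<open>i\<close>
  stands for $v_{i+1}$.\<close>

definition skew_adjacency :: "nat \<Rightarrow> nat pair_pre_digraph \<Rightarrow> int mat" where
  "skew_adjacency n G = mat n n (\<lambda>(i, j).
     if (i, j) \<in> parcs G then 1 else if (j, i) \<in> parcs G then -1 else 0)"

definition all_one_vec :: "nat \<Rightarrow> int vec" where
  "all_one_vec n = vec n (\<lambda>_. 1)"

definition all_one_mat :: "nat \<Rightarrow> int mat" where
  "all_one_mat n = mat n n (\<lambda>_. 1)"

definition skew_walk :: "nat \<Rightarrow> nat pair_pre_digraph \<Rightarrow> int mat" where
  "skew_walk n G =
     mat_of_cols n (map (\<lambda>k. (skew_adjacency n G ^\<^sub>m k) *\<^sub>v all_one_vec n) [0..<n])"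

definition controllable :: "nat \<Rightarrow> nat pair_pre_digraph \<Rightarrow> bool" where
  "controllable n G \<longleftrightarrow> det (skew_walk n G) \<noteq> 0"

text \<open>\<open>invertible_mat\<close> is taken over the integers, so \<open>P\<close> and \<open>Q\<close> are unimodular. All
  diagonal entries are positive because only nonsingular matrices are considered.\<close>

definition smith_normal_form :: "nat \<Rightarrow> int mat \<Rightarrow> int mat \<Rightarrow> bool" where
  "smith_normal_form n A D \<longleftrightarrow>
     A \<in> carrier_mat n n \<and> D \<in> carrier_mat n n \<and> diagonal_mat D \<and>
     (\<exists>P Q. P \<in> carrier_mat n n \<and> invertible_mat P \<and>
            Q \<in> carrier_mat n n \<and> invertible_mat Q \<and> D = P * A * Q) \<and>
     (\<forall>i < n. D $$ (i, i) > 0) \<and>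
     (\<forall>i. Suc i < n \<longrightarrow> D $$ (i, i) dvd D $$ (Suc i, Suc i))"


section \<open>Rank and nullity modulo a prime\<close>

text \<open>Since \<open>p\<close> ranges over the prime divisors of an integer, the field with \<open>p\<close> elements must
  depend on a term. It is represented by \<open>residue_ring p\<close>, with carrier \<open>{0..p - 1}\<close>, and its
  standard vector space of dimension \<open>n\<close> by the integer vectors with reduced entries. The
  multiplicative fields of the \<open>module\<close> record play no role.\<close>

definition vec_mod :: "int \<Rightarrow> int vec \<Rightarrow> int vec" where
  "vec_mod p = map_vec (\<lambda>x. x mod p)"

definition residue_vecs :: "int \<Rightarrow> nat \<Rightarrow> (int, int vec) module" where
  "residue_vecs p n =
     \<lparr>carrier = {v \<in> carrier_vec n. vec_mod p v = v},
      monoid.mult = undefined, one = undefined,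
      zero = 0\<^sub>v n, add = (\<lambda>u v. vec_mod p (u + v)),
      module.smult = (\<lambda>a v. vec_mod p (a \<cdot>\<^sub>v v))\<rparr>"

lemma vectorspace_residue_vecs:
  assumes "prime p"
  shows "vectorspace (residue_ring p) (residue_vecs p n)"
proof -
  have p1: "p > 1" using assms by (simp add: prime_gt_1_int)
  have res: "residues p" by unfold_locales (use p1 in simp)
  have fld: "field (residue_ring p)"
  proof -
    have "residues_prime (nat p)" by unfold_locales (use assms in auto)
    from residues_prime.is_field[OF this] show ?thesis using p1 by simp
  qed
  have carr: "v \<in> carrier (residue_vecs p n) \<longleftrightarrow>
      v \<in> carrier_vec n \<and> (\<forall>i<n. v $ i mod p = v $ i)" for v
    by (auto simp: residue_vecs_def vec_mod_def vec_eq_iff)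
  have "abelian_group (residue_vecs p n)"
  proof (rule abelian_groupI)
    fix x assume x: "x \<in> carrier (residue_vecs p n)"
    show "\<exists>y\<in>carrier (residue_vecs p n). y \<oplus>\<^bsub>residue_vecs p n\<^esub> x = \<zero>\<^bsub>residue_vecs p n\<^esub>"
      by (rule bexI[of _ "vec_mod p (- x)"])
        (use x in \<open>auto simp: carr\<close>, auto simp: residue_vecs_def vec_mod_def vec_eq_iff mod_simps)
  qed (auto simp: carr, auto simp: residue_vecs_def vec_mod_def vec_eq_iff mod_simps ac_simps)
  moreover have "cring (residue_ring p)" using res by (rule residues.cring)
  ultimately have "module (residue_ring p) (residue_vecs p n)"
    unfolding Module.module_def Module.module_axioms_def
    by (auto simp: carr)
      (auto simp: residue_vecs_def vec_mod_def vec_eq_iff residue_ring_def mod_simps algebra_simps)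
  with fld show ?thesis unfolding vectorspace_def by simp
qed

definition rank_mod :: "int \<Rightarrow> int mat \<Rightarrow> nat" where
  "rank_mod p A =
     vectorspace.dim (residue_ring p)
       ((residue_vecs p (dim_row A))
          \<lparr>carrier := LinearCombinations.module.span (residue_ring p)
             (residue_vecs p (dim_row A)) (vec_mod p ` set (cols A))\<rparr>)"

definition nullity_mod :: "int \<Rightarrow> int mat \<Rightarrow> nat" where
  "nullity_mod p A =
     vectorspace.dim (residue_ring p)
       ((residue_vecs p (dim_col A))
          \<lparr>carrier := {v \<in> carrier (residue_vecs p (dim_col A)).
             vec_mod p (A *\<^sub>v v) = 0\<^sub>v (dim_row A)}\<rparr>)"


section \<open>Polynomials modulo a prime\<close>

text \<open>Elements of $\mathbb{F}_p[x]$ are represented as in \<^theory>\<open>Berlekamp_Zassenhaus.Poly_Mod\<close>: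
  by integer polynomials with coefficients in \<open>{0..<p}\<close>, that is, those fixed by
  \<open>poly_mod.Mp p\<close>.\<close>

definition monic_mod :: "int \<Rightarrow> int poly \<Rightarrow> bool" where
  "monic_mod p f \<longleftrightarrow> poly_mod.Mp p f = f \<and> monic f"

text \<open>The monic greatest common divisor; it exists and is unique when \<open>p\<close> is prime and \<open>f\<close>, \<open>g\<close>
  do not both vanish modulo \<open>p\<close>.\<close>

definition gcd_mod :: "int \<Rightarrow> int poly \<Rightarrow> int poly \<Rightarrow> int poly" where
  "gcd_mod p f g = (THE d. monic_mod p d \<and> poly_mod.dvdm p d f \<and> poly_mod.dvdm p d g \<and>
     (\<forall>h. poly_mod.dvdm p h f \<and> poly_mod.dvdm p h g \<longrightarrow> poly_mod.dvdm p h d))"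

definition monic_irreducible_mod :: "int \<Rightarrow> int poly \<Rightarrow> bool" where
  "monic_irreducible_mod p f \<longleftrightarrow> monic_mod p f \<and> poly_mod.irreducible_m p f"

text \<open>The square-free part $\prod_i f_i$ of a monic $f = \prod_i f_i^{a_i}$.\<close>

definition sfp_mod :: "int \<Rightarrow> int poly \<Rightarrow> int poly" where
  "sfp_mod p f = (THE g. \<exists>F a. finite F \<and>
     (\<forall>q \<in> F. monic_irreducible_mod p q \<and> a q \<ge> (1::nat)) \<and>
     poly_mod.Mp p f = poly_mod.Mp p (\<Prod>q\<in>F. q ^ a q) \<and>
     g = poly_mod.Mp p (\<Prod>q\<in>F. q))"

definition Phi_mod :: "int \<Rightarrow> nat \<Rightarrow> nat pair_pre_digraph \<Rightarrow> int poly" where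
  "Phi_mod p n G =
     gcd_mod p (char_poly (skew_adjacency n G)) (char_poly (skew_adjacency n G + all_one_mat n))"

end

theory Submission
  imports Defs
begin

text \<open>Write \<open>e\<close> for the all-one vector. By controllability \<open>f(S) e \<mapsto> f(-S) e\<close> extends to a linear
  involution \<open>q\<close> of \<open>\<rat>\<^sup>n\<close>; as \<open>S\<close> is skew, \<open>q\<close> is orthogonal, and \<open>q e = e\<close>, \<open>q S = - S q\<close>. If \<open>q\<close>
  is integral, it is a permutation matrix, hence an isomorphism onto the converse.

  As \<open>d q\<close> is integral and \<open>d\<close> is square-free, it remains to show, for every prime \<open>p\<close> dividing \<open>d\<close>,
  that \<open>f(S) e \<equiv> 0\<close> implies \<open>f(-S) e \<equiv> 0\<close> modulo \<open>p\<close>. This is trivial for \<open>p = 2\<close>. For odd \<open>p\<close> let \<open>m\<close>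
  be the minimal polynomial of \<open>e\<close> modulo \<open>p\<close> and \<open>\<chi>(S) = m h\<close>; one needs \<open>m(-x) = \<plusminus>m(x)\<close>,
  equivalently \<open>h(-x) = \<plusminus>h(x)\<close>. The polynomial \<open>\<chi>(S) - \<chi>(S + J)\<close> is the image of
  \<open>(\<chi>(x) - \<chi>(y)) / (x - y)\<close> under \<open>y\<^sup>k \<mapsto> e\<^sup>T S\<^sup>k e\<close>, which is divisible by \<open>h\<close> modulo \<open>p\<close>.
  Conversely an irreducible common factor \<open>\<phi>\<close> of \<open>\<chi>(S)\<close> and \<open>\<chi>(S + J)\<close> divides \<open>h(x)\<close> or \<open>h(-x)\<close>:
  otherwise \<open>(m / \<phi>)(S) e\<close> is a nonzero vector orthogonal to all \<open>S\<^sup>k e\<close> and, as \<open>p\<^sup>2\<close> does not divide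
  \<open>d\<close>, to all of \<open>h(S) \<int>\<^sup>n\<close>. Condition (ii) makes the factors \<open>\<phi>\<close> symmetric, so the square-free part of
  \<open>\<Phi>\<close> divides \<open>h\<close>, and by (i) the two agree.\<close>

section \<open>Polynomials over a prime field\<close>

text \<open>The prime varies over the divisors of \<open>d\<close> within one proof, so it is a term
  and not a type; polynomials over the prime field remain integer polynomials compared by
  \<open>=m\<close>.\<close>

locale prime_modulus = poly_mod p for p :: int +
  assumes prime_p: "prime p"
begin

lemma p_gt_1: "p > 1"
  using prime_p by (rule prime_gt_1_int)

text \<open>Congruence turns into divisibility by the constant \<open>[:p:]\<close> among integer
  polynomials. Since \<open>[:p:]\<close> is a prime element there, cancellation modulo
  \<open>p\<close> follows.\<close>

lemma eq_m_iff_dvd: "f =m g \<longleftrightarrow> [:p:] dvd f - g"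
  by (simp add: poly_eq_iff Mp_coeff M_def const_poly_dvd_iff mod_eq_dvd_iff)

lemma eq_m_0_iff_dvd: "f =m 0 \<longleftrightarrow> [:p:] dvd f"
  using eq_m_iff_dvd[of f 0] by simp

lemma Mp_eq_0_iff_dvd: "Mp f = 0 \<longleftrightarrow> [:p:] dvd f"
  using eq_m_0_iff_dvd[of f] by simp

lemma dvdm_iff_dvd: "f dvdm g \<longleftrightarrow> (\<exists>h. [:p:] dvd g - f * h)"
  by (simp add: dvdm_def eq_m_iff_dvd)

lemma const_p_prime_elem: "prime_elem [:p:]"
  unfolding prime_elem_const_poly_iff using prime_p by (rule prime_imp_prime_elem)

lemma const_p_dvd_mult_iff: "[:p:] dvd f * g \<longleftrightarrow> [:p:] dvd f \<or> [:p:] dvd g"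
  by (rule prime_elem_dvd_mult_iff[OF const_p_prime_elem])

lemma eq_m_add: "f =m f' \<Longrightarrow> g =m g' \<Longrightarrow> f + g =m f' + g'"
  by (metis plus_Mp)

lemma eq_m_mult: "f =m f' \<Longrightarrow> g =m g' \<Longrightarrow> f * g =m f' * g'"
  by (metis mult_Mp)

lemma eq_m_cancel_left:
  assumes "f * g =m f * h" "\<not> f =m 0"
  shows "g =m h"
proof -
  have "[:p:] dvd f * (g - h)" using assms(1) by (simp add: eq_m_iff_dvd algebra_simps)
  with assms(2) show ?thesis by (simp only: const_p_dvd_mult_iff eq_m_iff_dvd diff_zero simp_thms)
qed

lemma dvdm_refl [simp]: "f dvdm f"
  unfolding dvdm_def by (rule exI[of _ 1]) simp

lemma dvdm_eq_m_trans: "f dvdm g \<Longrightarrow> g =m h \<Longrightarrow> f dvdm h"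
  by (simp add: dvdm_def)

lemma dvdm_triv_left [simp]: "f dvdm f * g"
  unfolding dvdm_def by blast

lemma dvdm_triv_right [simp]: "f dvdm g * f"
  unfolding dvdm_def by (metis mult.commute)

lemma dvdm_trans:
  assumes "f dvdm g" "g dvdm h"
  shows "f dvdm h"
proof -
  obtain a b where a: "g =m f * a" and b: "h =m g * b" using assms unfolding dvdm_def by blast
  have "h =m f * a * b" using b eq_m_mult[OF a refl, of b] by simp
  then show ?thesis unfolding dvdm_def by (metis mult.assoc)
qed

lemma dvdm_mult: "f dvdm g \<Longrightarrow> f dvdm h * g"
  using dvdm_trans dvdm_triv_right by blast

lemma dvdm_mult2: "f dvdm g \<Longrightarrow> f dvdm g * h"
  using dvdm_trans dvdm_triv_left by blast

lemma dvdm_add: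
  assumes "f dvdm g" "f dvdm h"
  shows "f dvdm g + h"
proof -
  obtain a b where ab: "g =m f * a" "h =m f * b" using assms unfolding dvdm_def by blast
  have "g + h =m f * (a + b)" using eq_m_add[OF ab] by (simp only: distrib_left)
  then show ?thesis unfolding dvdm_def by blast
qed

lemma dvdm_uminus: "f dvdm g \<Longrightarrow> f dvdm - g"
  using dvdm_mult[of f g "-1"] by simp

lemma dvdm_diff: "f dvdm g \<Longrightarrow> f dvdm h \<Longrightarrow> f dvdm g - h"
  using dvdm_add[of f g "- h"] dvdm_uminus[of f h] by simp

lemma dvdm_mult_mono:
  assumes "f dvdm g" "f' dvdm g'"
  shows "f * f' dvdm g * g'"
proof -
  obtain a b where "g =m f * a" "g' =m f' * b" using assms unfolding dvdm_def by blast
  then have "g * g' =m f * a * (f' * b)" by (rule eq_m_mult)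
  then show ?thesis unfolding dvdm_def by (intro exI[of _ "a * b"]) (simp add: ac_simps)
qed

lemma dvdm_left_if_unit:
  assumes "g =m f * h" "h dvdm 1"
  shows "g dvdm f"
proof -
  obtain k where k: "1 =m h * k" using assms(2) unfolding dvdm_def by blast
  have "f * 1 =m f * (h * k)" using k by (intro eq_m_mult) auto
  moreover have "g * k =m f * h * k" using assms(1) by (intro eq_m_mult) auto
  ultimately have "f =m g * k" by (simp add: mult.assoc)
  then show ?thesis unfolding dvdm_def by blast
qed

lemma irreducible_m_not_unit: "irreducible_m f \<Longrightarrow> \<not> f dvdm 1"
  unfolding irreducible_m_def by blast

lemma irreducible_m_not_0: "irreducible_m f \<Longrightarrow> \<not> f =m 0"
  unfolding irreducible_m_def by blast

lemma irreducible_mD: "irreducible_m f \<Longrightarrow> f =m a * b \<Longrightarrow> a dvdm 1 \<or> b dvdm 1"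
  unfolding irreducible_m_def by blast

lemma dvdm_1_imp_dvdm: "f dvdm 1 \<Longrightarrow> f dvdm g"
  using dvdm_mult[of f 1 g] by simp

lemma Mp_fixed_iff: "Mp f = f \<longleftrightarrow> (\<forall>i. 0 \<le> coeff f i \<and> coeff f i < p)"
proof -
  have "x mod p = x \<longleftrightarrow> 0 \<le> x \<and> x < p" for x
  proof
    assume "x mod p = x"
    then show "0 \<le> x \<and> x < p" using p_gt_1 pos_mod_sign[of p x] pos_mod_bound[of p x] by linarith
  qed (simp add: mod_pos_pos_trivial)
  then show ?thesis by (simp add: poly_eq_iff Mp_coeff M_def)
qed

lemma Mp_fixed_dvd: "Mp f = f \<Longrightarrow> [:p:] dvd f \<longleftrightarrow> f = 0"
  by (metis Mp_eq_0_iff_dvd)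

lemma Mp_fixed_lead_coeff:
  assumes "Mp f = f" "f \<noteq> 0"
  shows "\<not> p dvd lead_coeff f"
proof -
  have "0 \<le> lead_coeff f" "lead_coeff f < p" using assms(1) Mp_fixed_iff by blast+
  moreover have "lead_coeff f \<noteq> 0" using assms(2) by simp
  ultimately show ?thesis using zdvd_not_zless[of "lead_coeff f" p] by linarith
qed

lemma monic_not_const_p_dvd:
  assumes "monic f"
  shows "\<not> [:p:] dvd f"
  using assms p_gt_1 by (metis const_poly_dvd_iff not_prime_unit prime_p)

lemma monic_mod_Mp:
  assumes "monic f"
  shows "monic_mod p (Mp f)" "degree (Mp f) = degree f"
proof -
  show d: "degree (Mp f) = degree f"
    using assms p_gt_1 by (intro degree_m_eq) auto
  have "lead_coeff (Mp f) = M 1" using assms by (simp add: d Mp_coeff)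
  also have "\<dots> = 1" using p_gt_1 by (simp add: M_def)
  finally show "monic_mod p (Mp f)" by (simp add: monic_mod_def)
qed

text \<open>The leading coefficient of the product is that of \<open>g\<close>, which does not
  vanish modulo \<open>p\<close>; hence reduction keeps the degree.\<close>

lemma degree_Mp_mult:
  assumes "monic f" "Mp g = g" "g \<noteq> 0"
  shows "degree (Mp (f * g)) = degree f + degree g"
proof -
  have lc: "lead_coeff (f * g) = lead_coeff g" using assms by (simp add: lead_coeff_mult)
  have "degree (Mp (f * g)) = degree (f * g)"
    using Mp_fixed_lead_coeff[OF assms(2,3)] p_gt_1 by (intro degree_m_eq) (auto simp: lc dvd_eq_mod_eq_0)
  then show ?thesis using assms(1,3) by (subst (asm) degree_mult_eq) auto
qed

lemma dvdm_degree_le: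
  assumes "monic f" "Mp g = g" "g \<noteq> 0" "f dvdm g"
  shows "degree f \<le> degree g"
proof -
  obtain h where h: "g =m f * h" "Mp h = h" using assms(4) by (rule dvdmE)
  have "h \<noteq> 0" using h assms(2,3) by auto
  then show ?thesis using degree_Mp_mult[OF assms(1) h(2)] h(1) assms(2) by simp
qed

lemma Mp_fixed_unit:
  assumes "Mp f = f" "f \<noteq> 0" "degree f = 0"
  shows "f dvdm 1"
proof -
  obtain c where c: "f = [:c:]" using assms(3) by (auto elim: degree_eq_zeroE)
  have "\<not> p dvd c" using Mp_fixed_lead_coeff[OF assms(1,2)] c by simp
  then have "algebraic_semidom_class.coprime c p" by (rule prime_imp_coprime[OF prime_p, THEN algebraic_semidom_class.coprime_commute[THEN iffD1]])
  then obtain u where "[c * u = 1] (mod p)" using cong_solve_coprime_int by blast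
  then have "p dvd 1 - c * u" by (simp add: cong_iff_dvd_diff dvd_diff_commute)
  then obtain k where k: "1 - c * u = p * k" by (rule dvdE)
  have "1 - f * [:u:] = [:1 - c * u:]"
    by (rule poly_eqI) (simp add: c coeff_pCons mult.commute split: nat.split)
  also have "\<dots> = [:p:] * [:k:]" unfolding k by simp
  finally show ?thesis unfolding dvdm_iff_dvd by (metis dvd_triv_left)
qed

lemma unit_degree_0:
  assumes "monic f" "f dvdm 1"
  shows "degree f = 0"
proof -
  have "degree f \<le> degree (1 :: int poly)"
    using assms by (intro dvdm_degree_le) (use p_gt_1 in \<open>auto simp: Mp_fixed_iff\<close>)
  then show ?thesis by simp
qed

text \<open>The reduced quotient has degree 0 by comparing degrees, and comparing leading
  coefficients makes it 1. This is the uniqueness behind the definite description in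
  \<open>gcd_mod\<close>.\<close>

lemma monic_mod_antisym:
  assumes "monic_mod p f" "monic_mod p g" "f dvdm g" "g dvdm f"
  shows "f = g"
proof -
  have fg: "Mp f = f" "monic f" "f \<noteq> 0" "Mp g = g" "monic g" "g \<noteq> 0"
    using assms(1,2) by (auto simp: monic_mod_def)
  obtain h where h: "g =m f * h" "Mp h = h" using assms(3) by (rule dvdmE)
  have h0: "h \<noteq> 0" using h fg by auto
  have "degree g \<le> degree f" using dvdm_degree_le[OF fg(5) fg(1) fg(3) assms(4)] .
  moreover have "degree g = degree f + degree h" using degree_Mp_mult[OF fg(2) h(2) h0] h(1) fg(4) by simp
  ultimately have "degree h = 0" by simp
  then obtain c where c: "h = [:c:]" by (auto elim: degree_eq_zeroE)
  have dfg: "degree g = degree f" using \<open>degree g = degree f + degree h\<close> \<open>degree h = 0\<close> by simp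
  have "M (coeff g (degree g)) = M (coeff (f * h) (degree g))"
    using h(1) by (metis Mp_coeff)
  then have "M 1 = M c" using fg dfg by (simp add: c)
  moreover have "0 \<le> c" "c < p" using h(2) c unfolding Mp_fixed_iff by (metis coeff_pCons_0)+
  ultimately have "c = 1" using p_gt_1 by (simp add: M_def)
  then show ?thesis using h(1) c fg by simp
qed

end

text \<open>Pseudo-division multiplies \<open>f\<close> by a power of the leading coefficient of
  \<open>g\<close>, which is 1 here.\<close>

lemma monic_division:
  fixes f g :: "'a :: {comm_ring_1, semiring_1_no_zero_divisors} poly"
  assumes "monic g"
  obtains q r where "f = g * q + r" "r = 0 \<or> degree r < degree g"
proof -
  obtain q r where qr: "pseudo_divmod f g = (q, r)" by fastforce
  have "g \<noteq> 0" using assms by auto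
  from pseudo_divmod[OF this qr] assms that show thesis by simp
qed

section \<open>Ideals, greatest common divisors and factorization modulo a prime\<close>

context prime_modulus
begin

text \<open>\<open>I\<close> is an ideal of integer polynomials that contains \<open>p\<close> but
  is not contained in the ideal of \<open>p\<close>. A nonzero reduced element of least degree,
  scaled to be monic, generates it modulo \<open>p\<close>: remainders have smaller degree and so
  vanish.\<close>

lemma ideal_generator:
  assumes add: "\<And>f g. f \<in> I \<Longrightarrow> g \<in> I \<Longrightarrow> f + g \<in> I"
    and mult: "\<And>f g. f \<in> I \<Longrightarrow> g * f \<in> I"
    and p_in: "[:p:] \<in> I" and f0: "f0 \<in> I" "\<not> [:p:] dvd f0"
  obtains m where "monic_mod p m" "m \<in> I" "\<And>f. f \<in> I \<Longrightarrow> m dvdm f"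
proof -
  have Mp_in: "Mp f \<in> I" if "f \<in> I" for f
  proof -
    have "[:p:] dvd Mp f - f" by (simp flip: eq_m_iff_dvd)
    then obtain q where "Mp f = f + q * [:p:]" by (metis dvdE mult.commute diff_eq_eq add.commute)
    then show ?thesis using add mult p_in that by metis
  qed
  define P where "P k \<longleftrightarrow> (\<exists>f\<in>I. Mp f = f \<and> f \<noteq> 0 \<and> degree f = k)" for k
  have "P (degree (Mp f0))" unfolding P_def
    using f0 Mp_in by (intro bexI[of _ "Mp f0"]) (auto simp: Mp_eq_0_iff_dvd)
  then have "P (Least P)" by (rule LeastI)
  then obtain f where f: "f \<in> I" "Mp f = f" "f \<noteq> 0" "degree f = Least P" unfolding P_def by auto
  have "algebraic_semidom_class.coprime (lead_coeff f) p"
    using Mp_fixed_lead_coeff[OF f(2,3)] by (rule prime_imp_coprime[OF prime_p, THEN algebraic_semidom_class.coprime_commute[THEN iffD1]])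
  then obtain u where u: "[lead_coeff f * u = 1] (mod p)" using cong_solve_coprime_int by blast
  \<comment> \<open>\<open>u\<close> inverts the leading coefficient modulo \<open>p\<close>, so the
    rescaled polynomial keeps its degree and becomes monic.\<close>
  define m where "m = Mp ([:u:] * f)"
  have cm: "coeff m (degree f) = 1" using u p_gt_1
    by (simp add: m_def Mp_coeff M_def cong_def mult.commute)
  have dm: "degree m \<le> degree f" unfolding m_def
    by (rule order_trans[OF degree_m_le]) simp
  have "degree f \<le> degree m" using cm by (intro le_degree) simp
  then have dm': "degree m = degree f" using dm by simp
  have m: "monic_mod p m" using cm dm' by (simp add: monic_mod_def m_def)
  have mI: "m \<in> I" unfolding m_def by (intro Mp_in mult f)
  have "m dvdm g" if g: "g \<in> I" for g
  proof -
    have "monic m" using m by (simp add: monic_mod_def)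
    then obtain q r where qr: "g = m * q + r" "r = 0 \<or> degree r < degree m" by (rule monic_division)
    have "r = g + (- q) * m" using qr by (simp add: algebra_simps)
    then have "Mp r \<in> I" using add[OF g mult[OF mI]] Mp_in by metis
    have "Mp r = 0"
    proof (rule ccontr)
      assume nz: "Mp r \<noteq> 0"
      then have "P (degree (Mp r))"
        using \<open>Mp r \<in> I\<close> unfolding P_def by (intro bexI[of _ "Mp r"]) simp_all
      then have "Least P \<le> degree (Mp r)" by (rule Least_le)
      also have "\<dots> \<le> degree r" by (rule degree_m_le)
      finally show False using qr(2) nz dm' f(4) by auto
    qed
    then have "[:p:] dvd g - m * q" using qr by (simp add: Mp_eq_0_iff_dvd)
    then show ?thesis by (auto simp: dvdm_iff_dvd)
  qed
  with that m mI show thesis by blast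
qed

text \<open>The ideal spanned by \<open>f\<close>, \<open>g\<close> and the constant
  \<open>[:p:]\<close> has a generator modulo \<open>p\<close>; including \<open>[:p:]\<close> is
  what closes it under reduction.\<close>

lemma bezout_mod:
  assumes "\<not> f =m 0"
  obtains d u v where "monic_mod p d" "d dvdm f" "d dvdm g" "d =m u * f + v * g"
proof -
  define I where "I = {u * f + v * g + w * [:p:] | u v w. True}"
  have "\<exists>d. monic_mod p d \<and> d \<in> I \<and> (\<forall>h\<in>I. d dvdm h)"
  proof (rule ideal_generator[of I f])
    fix a b assume "a \<in> I" "b \<in> I"
    then obtain u v w u' v' w' where "a = u * f + v * g + w * [:p:]" "b = u' * f + v' * g + w' * [:p:]"
      unfolding I_def by blast
    then have "a + b = (u + u') * f + (v + v') * g + (w + w') * [:p:]"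
      by (simp only: distrib_right add.assoc add.left_commute)
    then show "a + b \<in> I" unfolding I_def by blast
  next
    fix a b assume "a \<in> I"
    then obtain u v w where "a = u * f + v * g + w * [:p:]" unfolding I_def by blast
    then have "b * a = (b * u) * f + (b * v) * g + (b * w) * [:p:]" by (simp only: distrib_left mult.assoc)
    then show "b * a \<in> I" unfolding I_def by blast
  next
    have "[:p:] = 0 * f + 0 * g + 1 * [:p:]" by simp
    then show "[:p:] \<in> I" unfolding I_def by blast
  next
    have "f = 1 * f + 0 * g + 0 * [:p:]" by simp
    then show "f \<in> I" unfolding I_def by blast
  next
    show "\<not> [:p:] dvd f" using assms by (simp flip: Mp_eq_0_iff_dvd)
  qed blast
  then obtain d where d: "monic_mod p d" "d \<in> I" "\<And>h. h \<in> I \<Longrightarrow> d dvdm h" by blast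
  obtain u v w where uvw: "d = u * f + v * g + w * [:p:]" using d(2) unfolding I_def by blast
  have 1: "d =m u * f + v * g" unfolding eq_m_iff_dvd uvw by (simp del: mult_pCons_right)
  have "g = 0 * f + 1 * g + 0 * [:p:]" "f = 1 * f + 0 * g + 0 * [:p:]" by simp_all
  then have "d dvdm g" "d dvdm f" using d(3) unfolding I_def by blast+
  with that d 1 show thesis by blast
qed

text \<open>The Bezout identity makes every common divisor divide \<open>d\<close>, and antisymmetry
  makes \<open>d\<close> unique, so the definite description in \<open>gcd_mod\<close>
  denotes.\<close>

lemma gcd_mod_spec:
  assumes "\<not> f =m 0"
  shows "monic_mod p (gcd_mod p f g)" "gcd_mod p f g dvdm f" "gcd_mod p f g dvdm g"
    "\<And>h. h dvdm f \<Longrightarrow> h dvdm g \<Longrightarrow> h dvdm gcd_mod p f g"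
proof -
  define P where "P d \<longleftrightarrow> monic_mod p d \<and> d dvdm f \<and> d dvdm g \<and>
    (\<forall>h. h dvdm f \<and> h dvdm g \<longrightarrow> h dvdm d)" for d
  obtain d u v where d: "monic_mod p d" "d dvdm f" "d dvdm g" "d =m u * f + v * g"
    using bezout_mod[OF assms] by blast
  have "h dvdm d" if "h dvdm f" "h dvdm g" for h
  proof -
    have "h dvdm u * f + v * g" by (intro dvdm_add dvdm_mult that)
    then show ?thesis using d(4) dvdm_eq_m_trans by metis
  qed
  then have "P d" unfolding P_def using d by blast
  moreover have "d' = d" if "P d'" for d'
    using that \<open>P d\<close> unfolding P_def by (intro monic_mod_antisym) auto
  ultimately have "P (gcd_mod p f g)" unfolding gcd_mod_def P_def[symmetric] by (rule theI)
  note spec = this[unfolded P_def]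
  show "monic_mod p (gcd_mod p f g)" by (rule spec[THEN conjunct1])
  show "gcd_mod p f g dvdm f" by (rule spec[THEN conjunct2, THEN conjunct1])
  show "gcd_mod p f g dvdm g" by (rule spec[THEN conjunct2, THEN conjunct2, THEN conjunct1])
  show "h dvdm gcd_mod p f g" if "h dvdm f" "h dvdm g" for h
    using spec that by (elim conjE allE[of _ h] impE) (rule conjI)
qed

lemma irreducible_mod_bezout:
  assumes "irreducible_m f" "\<not> f dvdm g"
  obtains u v where "1 =m u * f + v * g"
proof -
  have "\<not> f =m 0" using assms(1) by (rule irreducible_m_not_0)
  from bezout_mod[OF this, of g]
  obtain d u v where d: "monic_mod p d" "d dvdm f" "d dvdm g" "d =m u * f + v * g" .
  obtain h where h: "f =m d * h" using d(2) unfolding dvdm_def by blast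
  have "d dvdm 1"
  proof (rule ccontr)
    assume "\<not> d dvdm 1"
    then have "h dvdm 1" using irreducible_mD[OF assms(1) h] by blast
    then have "f dvdm d" using dvdm_left_if_unit h by blast
    then show False using d(3) assms(2) dvdm_trans by blast
  qed
  then obtain k where k: "1 =m d * k" unfolding dvdm_def by blast
  have "d * k =m (u * f + v * g) * k" using d(4) by (intro eq_m_mult) auto
  then have "1 =m (u * k) * f + (v * k) * g" using k by (simp add: algebra_simps)
  then show thesis by (rule that)
qed

lemma irreducible_mod_prime:
  assumes "irreducible_m f" "f dvdm g * h" "\<not> f dvdm g"
  shows "f dvdm h"
proof -
  obtain u v where uv: "1 =m u * f + v * g" using irreducible_mod_bezout[OF assms(1,3)] .
  have "1 * h =m (u * f + v * g) * h" using uv by (intro eq_m_mult) auto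
  then have 1: "(u * h) * f + v * (g * h) =m h" by (simp add: algebra_simps)
  have "f dvdm (u * h) * f + v * (g * h)" by (intro dvdm_add dvdm_mult assms dvdm_refl)
  then show ?thesis using 1 by (rule dvdm_eq_m_trans)
qed

lemma monic_irreducible_dvdm_imp_eq:
  assumes "monic_irreducible_mod p f" "monic_irreducible_mod p g" "f dvdm g"
  shows "f = g"
proof -
  obtain h where h: "g =m f * h" using assms(3) unfolding dvdm_def by blast
  have "\<not> f dvdm 1" using assms(1) irreducible_m_not_unit by (simp add: monic_irreducible_mod_def)
  moreover have "irreducible_m g" using assms(2) by (simp add: monic_irreducible_mod_def)
  ultimately have "h dvdm 1" using irreducible_mD h by blast
  then have "g dvdm f" using dvdm_left_if_unit h by blast
  then show ?thesis using assms by (intro monic_mod_antisym) (auto simp: monic_irreducible_mod_def)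
qed

lemma irreducible_dvdm_prod:
  assumes "irreducible_m f" "finite A" "f dvdm (\<Prod>q\<in>A. g q)"
  shows "\<exists>q\<in>A. f dvdm g q"
  using assms(2,3)
proof (induction A rule: finite_induct)
  case empty
  have "\<not> f dvdm prod g {}" unfolding prod.empty by (rule irreducible_m_not_unit[OF assms(1)])
  then show ?case using empty by (rule notE)
next
  case (insert a A)
  have "f dvdm g a * prod g A" using insert.prems unfolding prod.insert[OF insert.hyps] .
  then have "f dvdm g a \<or> f dvdm prod g A" using irreducible_mod_prime[OF assms(1)] by blast
  then show ?case using insert.IH by blast
qed

lemma irreducible_dvdm_power:
  assumes "irreducible_m f" "f dvdm g ^ k"
  shows "f dvdm g"
  using assms(2)
proof (induction k)
  case 0
  then show ?case using irreducible_m_not_unit[OF assms(1)] by simp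
next
  case (Suc k)
  then have "f dvdm g * g ^ k" by simp
  then show ?case using irreducible_mod_prime[OF assms(1)] Suc.IH by blast
qed

text \<open>Distinct monic irreducibles cannot divide one another, so by Euclid's lemma
  (\<open>irreducible_mod_prime\<close>) each new factor divides the cofactor.\<close>

lemma prod_dvdm:
  assumes "finite A" "\<And>q. q \<in> A \<Longrightarrow> monic_irreducible_mod p q" "\<And>q. q \<in> A \<Longrightarrow> q dvdm f"
  shows "\<Prod>A dvdm f"
  using assms
proof (induction A rule: finite_induct)
  case empty
  then show ?case by (simp add: dvdm_1_imp_dvdm)
next
  case (insert a A)
  obtain g where g: "f =m \<Prod>A * g" using insert unfolding dvdm_def by blast
  have irr: "irreducible_m a" using insert by (simp add: monic_irreducible_mod_def)
  have "\<not> a dvdm \<Prod>A"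
  proof
    assume "a dvdm \<Prod>A"
    then obtain q where "q \<in> A" "a dvdm q"
      using irreducible_dvdm_prod[OF irr \<open>finite A\<close>, of "\<lambda>q. q"] by auto
    then show False using monic_irreducible_dvdm_imp_eq[of a q] insert by auto
  qed
  moreover have "a dvdm \<Prod>A * g" using insert(5)[of a] g dvdm_eq_m_trans by blast
  ultimately have "a dvdm g" using irreducible_mod_prime[OF irr] by blast
  then have "a * \<Prod>A dvdm g * \<Prod>A" by (intro dvdm_mult_mono) auto
  then show ?case using g insert by (simp add: mult.commute dvdm_eq_m_trans)
qed

lemma monic_irreducible_factor:
  assumes "monic_mod p f" "degree f > 0"
  shows "\<exists>q. monic_irreducible_mod p q \<and> q dvdm f"
  using assms
proof (induction "degree f" arbitrary: f rule: less_induct)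
  case less
  have f: "Mp f = f" "monic f" "f \<noteq> 0" using less.prems by (auto simp: monic_mod_def)
  show ?case
  proof (cases "\<exists>g. monic_mod p g \<and> g dvdm f \<and> 0 < degree g \<and> degree g < degree f")
    case True
    then show ?thesis using less.hyps dvdm_trans by blast
  next
    case False
    have "irreducible_m f" unfolding irreducible_m_def
    proof (intro conjI allI impI)
      show "\<not> f =m 0" using f by simp
      show "\<not> f dvdm 1" using unit_degree_0 f(2) less.prems by force
      fix a b assume ab: "f =m a * b"
      then have "\<not> a =m 0" "\<not> b =m 0"
        using f by (auto simp: eq_m_0_iff_dvd) (metis Mp_fixed_dvd Mp_eq_0_iff_dvd dvd_mult2 dvd_mult)+
      have a_f: "a dvdm f" using ab unfolding dvdm_def by blast
      \<comment> \<open>\<open>bezout_mod\<close> with \<open>a\<close> in both places yields a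
        reduced monic associate of \<open>a\<close>, to which the degree alternative
        applies.\<close>
      obtain d u v where d: "monic_mod p d" "d dvdm a" "d dvdm a" "d =m u * a + v * a"
        using bezout_mod[OF \<open>\<not> a =m 0\<close>, of a] .
      have ad: "a dvdm d" using d(4) dvdm_eq_m_trans[of a "u * a + v * a" d] by (simp add: dvdm_add)
      have dm: "monic d" using d(1) by (simp add: monic_mod_def)
      have df: "d dvdm f" using d(2) a_f dvdm_trans by blast
      then have "degree d \<le> degree f" using dm f by (intro dvdm_degree_le)
      then consider "degree d = 0" | "degree d = degree f" using False d(1) df by fastforce
      then show "a dvdm 1 \<or> b dvdm 1"
      proof cases
        case 1
        then have "d = 1" using dm by (metis monic_degree_0)
        then show ?thesis using ad by simp
      next
        case 2
        obtain h where h: "f =m d * h" "Mp h = h" using df by (rule dvdmE)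
        have h0: "h \<noteq> 0" using h f by auto
        have "degree f = degree d + degree h" using degree_Mp_mult[OF dm h(2) h0] h(1) f(1) by metis
        then have "degree h = 0" using 2 by simp
        then have "h dvdm 1" using Mp_fixed_unit h(2) h0 by blast
        then have "f dvdm d" using dvdm_left_if_unit h(1) by blast
        then have "f dvdm a" using d(2) dvdm_trans by blast
        then obtain k where "a =m f * k" unfolding dvdm_def by blast
        moreover have "f * k =m a * b * k" using ab by (intro eq_m_mult) auto
        ultimately have "a * 1 =m a * (b * k)" by (simp add: mult.assoc)
        then have "1 =m b * k" using eq_m_cancel_left \<open>\<not> a =m 0\<close> by blast
        then show ?thesis unfolding dvdm_def by blast
      qed
    qed
    then have "monic_irreducible_mod p f" using less.prems by (simp add: monic_irreducible_mod_def)
    then show ?thesis using dvdm_refl by blast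
  qed
qed

lemma monic_factorization:
  assumes "monic_mod p f"
  shows "\<exists>F. (\<forall>q\<in>#F. monic_irreducible_mod p q) \<and> f =m prod_mset F"
  using assms
proof (induction "degree f" arbitrary: f rule: less_induct)
  case less
  have f: "Mp f = f" "monic f" "f \<noteq> 0" using less.prems by (auto simp: monic_mod_def)
  show ?case
  proof (cases "degree f = 0")
    case True
    then have "f = 1" using f(2) by (metis monic_degree_0)
    then show ?thesis by (intro exI[of _ "{#}"]) simp
  next
    case False
    then obtain q where q: "monic_irreducible_mod p q" "q dvdm f"
      using monic_irreducible_factor less.prems by blast
    have qm: "monic q" "Mp q = q" using q(1) by (auto simp: monic_irreducible_mod_def monic_mod_def)
    obtain g where g: "f =m q * g" "Mp g = g" using q(2) by (rule dvdmE)
    have g0: "g \<noteq> 0" using g(1) f(1,3) by (metis Mp_0 mult_zero_right)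
    have dg: "degree f = degree q + degree g" using degree_Mp_mult[OF qm(1) g(2) g0] g(1) f(1) by metis
    have "degree q \<noteq> 0"
    proof
      assume "degree q = 0"
      then have "q = 1" using qm(1) by (metis monic_degree_0)
      then show False
        using q(1) irreducible_m_not_unit[of q] by (simp add: monic_irreducible_mod_def)
    qed
    \<comment> \<open>Comparing coefficients in the top degree shows that the cofactor
      \<open>g\<close> is monic, as the induction requires.\<close>
    have "coeff (q * g) (degree f) = lead_coeff g" using qm(1) by (simp add: dg coeff_mult_degree_sum)
    then have "M (lead_coeff f) = M (lead_coeff g)" using arg_cong[OF g(1), of "\<lambda>h. coeff h (degree f)"]
      by (simp only: Mp_coeff)
    moreover have "M (lead_coeff g) = lead_coeff g" using g(2) by (metis Mp_coeff)
    ultimately have "M 1 = lead_coeff g" using f(2) by simp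
    then have "monic g" using p_gt_1 by (simp add: M_def)
    then have "\<exists>F. (\<forall>q\<in>#F. monic_irreducible_mod p q) \<and> g =m prod_mset F"
      using dg g(2) \<open>degree q \<noteq> 0\<close> by (intro less.hyps) (simp_all add: monic_mod_def)
    then obtain F where F: "\<forall>q\<in>#F. monic_irreducible_mod p q" "g =m prod_mset F" by blast
    have "f =m q * prod_mset F" using g(1) eq_m_mult[OF refl F(2), of q] by simp
    then show ?thesis using F(1) q(1) by (intro exI[of _ "add_mset q F"]) auto
  qed
qed

text \<open>The base set of any factorization of \<open>f\<close> into irreducible powers is forced
  to be the set of its monic irreducible divisors (\<open>key\<close>), whatever the exponents; so
  the description in \<open>sfp_mod\<close> has exactly one solution.\<close>

lemma sfp_mod_spec:
  assumes "monic_mod p f"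
  defines "F \<equiv> {q. monic_irreducible_mod p q \<and> q dvdm f}"
  shows "finite F" "sfp_mod p f = Mp (\<Prod>F)"
proof -
  have key: "F' = F" if F': "finite F'" "\<forall>q\<in>F'. monic_irreducible_mod p q \<and> a q \<ge> (1 :: nat)"
    "f =m (\<Prod>q\<in>F'. q ^ a q)" for F' a
  proof (intro equalityI subsetI)
    fix q assume q: "q \<in> F'"
    have "q dvdm q ^ a q" using F'(2) q by (cases "a q") auto
    moreover have "(\<Prod>q\<in>F'. q ^ a q) = q ^ a q * (\<Prod>q\<in>F' - {q}. q ^ a q)"
      using F'(1) q by (rule prod.remove)
    ultimately have "q dvdm (\<Prod>q\<in>F'. q ^ a q)" by (simp add: dvdm_mult2)
    then show "q \<in> F" using F' q by (simp add: F_def) (metis dvdm_eq_m_trans)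
  next
    fix q assume "q \<in> F"
    then have q: "monic_irreducible_mod p q" "q dvdm f" by (auto simp: F_def)
    have irr: "irreducible_m q" using q(1) by (simp add: monic_irreducible_mod_def)
    have "q dvdm (\<Prod>q\<in>F'. q ^ a q)" using q(2) F'(3) dvdm_eq_m_trans by blast
    then obtain q' where q': "q' \<in> F'" "q dvdm q' ^ a q'"
      using irreducible_dvdm_prod[OF irr F'(1)] by blast
    then have "q dvdm q'" using irreducible_dvdm_power[OF irr] by blast
    then show "q \<in> F'" using monic_irreducible_dvdm_imp_eq[of q q'] q(1) F'(2) q'(1) by auto
  qed
  obtain X where X: "\<forall>q\<in>#X. monic_irreducible_mod p q" "f =m prod_mset X"
    using monic_factorization[OF assms(1)] by blast
  have X': "f =m (\<Prod>q\<in>set_mset X. q ^ count X q)" using X(2) by (simp add: prod_mset_multiplicity)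
  have X1: "\<forall>q\<in>set_mset X. monic_irreducible_mod p q \<and> count X q \<ge> 1"
    using X(1) by (auto simp: Suc_le_eq)
  have XF: "set_mset X = F" using key[OF finite_set_mset X1 X'] .
  then show "finite F" by (metis finite_set_mset)
  show "sfp_mod p f = Mp (\<Prod>F)" unfolding sfp_mod_def
  proof (rule the_equality)
    show "\<exists>F' a. finite F' \<and> (\<forall>q\<in>F'. monic_irreducible_mod p q \<and> a q \<ge> (1 :: nat)) \<and>
       f =m (\<Prod>q\<in>F'. q ^ a q) \<and> Mp (\<Prod>F) = Mp (\<Prod>q\<in>F'. q)"
      using X1 X' XF by (intro exI[of _ "set_mset X"] exI[of _ "count X"]) auto
  next
    fix g assume "\<exists>F' a. finite F' \<and> (\<forall>q\<in>F'. monic_irreducible_mod p q \<and> a q \<ge> (1 :: nat)) \<and>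
       f =m (\<Prod>q\<in>F'. q ^ a q) \<and> g = Mp (\<Prod>q\<in>F'. q)"
    then show "g = Mp (\<Prod>F)" using key by blast
  qed
qed

end

section \<open>Evaluating integer polynomials at a matrix\<close>

text \<open>The vector f(A) v, obtained by Horner's scheme; the matrix f(A) is never formed.\<close>

definition mat_poly_vec :: "int mat \<Rightarrow> int vec \<Rightarrow> int poly \<Rightarrow> int vec" where
  "mat_poly_vec A v f = fold_coeffs (\<lambda>a w. a \<cdot>\<^sub>v v + A *\<^sub>v w) f (0\<^sub>v (dim_vec v))"

abbreviation (input) reflect_arg :: "int poly \<Rightarrow> int poly" where
  "reflect_arg f \<equiv> pcompose f [:0, -1:]"

lemma reflect_arg_pCons: "reflect_arg (pCons a f) = pCons a (- reflect_arg f)"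
  by (simp add: pcompose_pCons)

lemma reflect_arg_reflect_arg [simp]: "reflect_arg (reflect_arg f) = f"
  by (induction f) (simp_all add: reflect_arg_pCons pcompose_uminus)

lemma coeff_reflect_arg: "coeff (reflect_arg f) i = (-1) ^ i * coeff f i"
  by (induction f arbitrary: i) (auto simp: reflect_arg_pCons coeff_pCons split: nat.split)

lemma (in prime_modulus) reflect_arg_eq_m:
  assumes "f =m g"
  shows "reflect_arg f =m reflect_arg g"
  using assms by (simp add: eq_m_iff_dvd const_poly_dvd_iff flip: pcompose_diff)
    (simp add: coeff_reflect_arg)

lemma (in prime_modulus) reflect_arg_dvdm:
  assumes "f dvdm g"
  shows "reflect_arg f dvdm reflect_arg g"
proof -
  obtain h where "g =m f * h" using assms unfolding dvdm_def by blast
  then have "reflect_arg g =m reflect_arg f * reflect_arg h"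
    using reflect_arg_eq_m pcompose_mult by metis
  then show ?thesis unfolding dvdm_def by blast
qed

lemma mult_mat_smult_vec:
  fixes A :: "'a :: comm_ring mat"
  assumes "A \<in> carrier_mat m n" "v \<in> carrier_vec n"
  shows "A *\<^sub>v (k \<cdot>\<^sub>v v) = k \<cdot>\<^sub>v (A *\<^sub>v v)"
  using assms by (intro eq_vecI) (auto simp: scalar_prod_smult_distrib[of _ n])

context
  fixes A :: "int mat" and n :: nat
  assumes A: "A \<in> carrier_mat n n"
begin

lemma mat_poly_vec_0: "v \<in> carrier_vec n \<Longrightarrow> mat_poly_vec A v 0 = 0\<^sub>v n"
  by (simp add: mat_poly_vec_def)

lemma mat_poly_vec_carrier: "v \<in> carrier_vec n \<Longrightarrow> mat_poly_vec A v f \<in> carrier_vec n"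
  using A by (induction f) (auto simp: mat_poly_vec_def)

lemma mat_poly_vec_pCons:
  assumes "v \<in> carrier_vec n"
  shows "mat_poly_vec A v (pCons a f) = a \<cdot>\<^sub>v v + A *\<^sub>v mat_poly_vec A v f"
proof (cases "a = 0 \<and> f = 0")
  case True
  have "0\<^sub>v n = 0 \<cdot>\<^sub>v v + A *\<^sub>v 0\<^sub>v n" using A assms by (intro eq_vecI) auto
  then show ?thesis using True assms by (simp add: mat_poly_vec_0)
qed (auto simp: mat_poly_vec_def)

lemma mat_poly_vec_const: "v \<in> carrier_vec n \<Longrightarrow> mat_poly_vec A v [:a:] = a \<cdot>\<^sub>v v"
  using A by (subst mat_poly_vec_pCons) (auto simp: mat_poly_vec_0 intro!: eq_vecI)

lemma mat_poly_vec_1: "v \<in> carrier_vec n \<Longrightarrow> mat_poly_vec A v 1 = v"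
  using mat_poly_vec_const[of v 1] by simp

lemma mat_poly_vec_linear: "v \<in> carrier_vec n \<Longrightarrow> mat_poly_vec A v [:0, a:] = a \<cdot>\<^sub>v (A *\<^sub>v v)"
  using A by (subst mat_poly_vec_pCons) (auto simp: mat_poly_vec_const intro!: eq_vecI)

lemma mat_poly_vec_dim: "v \<in> carrier_vec n \<Longrightarrow> dim_vec (mat_poly_vec A v f) = n"
  by (rule carrier_vecD[OF mat_poly_vec_carrier])

lemma mat_poly_vec_add:
  assumes v: "v \<in> carrier_vec n"
  shows "mat_poly_vec A v (f + g) = mat_poly_vec A v f + mat_poly_vec A v g"
proof (induction f g rule: poly_induct2)
  case 0
  then show ?case using v by (simp add: mat_poly_vec_0)
next
  case (pCons a f b g)
  note c = mat_poly_vec_carrier[OF v]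
  have "mat_poly_vec A v (pCons a f + pCons b g)
      = (a + b) \<cdot>\<^sub>v v + (A *\<^sub>v mat_poly_vec A v f + A *\<^sub>v mat_poly_vec A v g)"
    using pCons by (simp add: mat_poly_vec_pCons[OF v] mult_add_distrib_mat_vec[OF A c c])
  also have "\<dots> = a \<cdot>\<^sub>v v + A *\<^sub>v mat_poly_vec A v f + (b \<cdot>\<^sub>v v + A *\<^sub>v mat_poly_vec A v g)"
    using v A c by (intro eq_vecI) (auto simp: algebra_simps)
  finally show ?case by (simp add: mat_poly_vec_pCons[OF v])
qed

lemma mat_poly_vec_smult:
  assumes v: "v \<in> carrier_vec n"
  shows "mat_poly_vec A v (smult a f) = a \<cdot>\<^sub>v mat_poly_vec A v f"
proof (induction f)
  case 0
  then show ?case using v by (auto simp: mat_poly_vec_0 intro!: eq_vecI)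
next
  case (pCons b f)
  note c = mat_poly_vec_carrier[OF v]
  have "mat_poly_vec A v (smult a (pCons b f)) = (a * b) \<cdot>\<^sub>v v + a \<cdot>\<^sub>v (A *\<^sub>v mat_poly_vec A v f)"
    using pCons by (simp add: mat_poly_vec_pCons[OF v] mult_mat_smult_vec[OF A c])
  also have "\<dots> = a \<cdot>\<^sub>v (b \<cdot>\<^sub>v v + A *\<^sub>v mat_poly_vec A v f)"
    using v A c by (intro eq_vecI) (auto simp: algebra_simps)
  finally show ?case by (simp add: mat_poly_vec_pCons[OF v])
qed

lemma mat_poly_vec_uminus:
  assumes v: "v \<in> carrier_vec n"
  shows "mat_poly_vec A v (- f) = - mat_poly_vec A v f"
proof -
  have "mat_poly_vec A v (smult (-1) f) = (-1) \<cdot>\<^sub>v mat_poly_vec A v f"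
    by (rule mat_poly_vec_smult[OF v])
  then show ?thesis by (auto intro!: eq_vecI)
qed

text \<open>Makes the integer vectors a module over the integer polynomials; commutativity of that
  ring then lets polynomials change places.\<close>

lemma mat_poly_vec_mult:
  assumes v: "v \<in> carrier_vec n"
  shows "mat_poly_vec A v (f * g) = mat_poly_vec A (mat_poly_vec A v g) f"
proof (induction f)
  case 0
  then show ?case using v by (simp add: mat_poly_vec_0 mat_poly_vec_carrier)
next
  case (pCons a f)
  show ?case
    using pCons v by (simp add: mat_poly_vec_add mat_poly_vec_smult mat_poly_vec_pCons mat_poly_vec_carrier)
      (use A v mat_poly_vec_carrier in \<open>auto intro!: eq_vecI\<close>)
qed

lemma mat_poly_vec_monom:
  assumes v: "v \<in> carrier_vec n"
  shows "mat_poly_vec A v (monom 1 k) = (A ^\<^sub>m k) *\<^sub>v v"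
proof (induction k)
  case 0
  then show ?case using v A by (simp add: monom_0 mat_poly_vec_1)
next
  case (Suc k)
  have "A ^\<^sub>m k * A = A * A ^\<^sub>m k"
    using A by (induction k) (auto simp: assoc_mult_mat[of _ n n _ n _ n])
  then have "A ^\<^sub>m Suc k *\<^sub>v v = A *\<^sub>v (A ^\<^sub>m k *\<^sub>v v)"
    using A v by (simp add: assoc_mult_mat_vec[of _ n n _ n])
  moreover have "mat_poly_vec A v (monom 1 (Suc k)) = A *\<^sub>v (A ^\<^sub>m k *\<^sub>v v)"
    using Suc v A by (auto simp: monom_Suc mat_poly_vec_pCons intro!: eq_vecI)
  ultimately show ?case by simp
qed

lemma mat_poly_vec_sum_index:
  assumes v: "v \<in> carrier_vec n" and "finite I" "i < n"
  shows "mat_poly_vec A v (\<Sum>k\<in>I. f k) $ i = (\<Sum>k\<in>I. mat_poly_vec A v (f k) $ i)"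
  using assms(2)
proof (induction I rule: finite_induct)
  case empty
  then show ?case using v assms(3) by (simp add: mat_poly_vec_0)
next
  case (insert k I)
  then show ?case using v assms(3) by (simp add: mat_poly_vec_add mat_poly_vec_dim)
qed

lemma mat_poly_vec_dvd:
  assumes v: "v \<in> carrier_vec n" and "[:p:] dvd f" "i < n"
  shows "p dvd mat_poly_vec A v f $ i"
proof -
  obtain g where "f = smult p g" using assms(2) by (auto elim!: dvdE)
  then show ?thesis using v assms(3) by (simp add: mat_poly_vec_smult mat_poly_vec_dim)
qed

text \<open>Dividing the vector by \<open>p\<close> gives an integral \<open>w\<close>, and the
  factor \<open>p\<close> reappears as the constant polynomial \<open>[:p:]\<close>.\<close>

lemma mat_poly_vec_dvd_mult:
  assumes v: "v \<in> carrier_vec n" and "\<And>i. i < n \<Longrightarrow> p dvd mat_poly_vec A v f $ i" "i < n"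
  shows "p dvd mat_poly_vec A v (g * f) $ i"
proof -
  define w where "w = vec n (\<lambda>i. mat_poly_vec A v f $ i div p)"
  have w: "w \<in> carrier_vec n" by (simp add: w_def)
  have "mat_poly_vec A v f = p \<cdot>\<^sub>v w"
    using assms(2) v by (intro eq_vecI) (auto simp: w_def mat_poly_vec_dim)
  also have "\<dots> = mat_poly_vec A w [:p:]"
    using w by (simp add: mat_poly_vec_const)
  finally have "mat_poly_vec A v (g * f) = mat_poly_vec A w (g * [:p:])"
    by (simp only: mat_poly_vec_mult[OF v] mat_poly_vec_mult[OF w])
  then show ?thesis using mat_poly_vec_dvd[OF w _ assms(3), of p "g * [:p:]"] by (simp only: dvd_triv_right)
qed

text \<open>Each time \<open>A\<close> crosses the scalar product its sign changes, which turns f(x)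
  into f(-x). Skewness enters the later arguments through this identity.\<close>

lemma mat_poly_vec_pairing:
  assumes skew: "transpose_mat A = - A" and v: "v \<in> carrier_vec n" and w: "w \<in> carrier_vec n"
  shows "w \<bullet> mat_poly_vec A v f = mat_poly_vec A w (reflect_arg f) \<bullet> v"
proof -
  have pair: "x \<bullet> (A *\<^sub>v y) = - (A *\<^sub>v x) \<bullet> y" if "x \<in> carrier_vec n" "y \<in> carrier_vec n" for x y
  proof -
    have "x \<bullet> (A *\<^sub>v y) = (transpose_mat A *\<^sub>v x) \<bullet> y"
      using transpose_vec_mult_scalar[OF A that(2,1)] that A
      by (metis comm_scalar_prod mult_mat_vec_carrier transpose_carrier_mat)
    also have "transpose_mat A *\<^sub>v x = - (A *\<^sub>v x)" using that A by (simp add: skew)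
    finally show ?thesis .
  qed
  show ?thesis using w
  \<comment> \<open>\<open>w\<close> is generalized because one Horner step applies the hypothesis
    to \<open>- (A *\<^sub>v w)\<close>.\<close>
  proof (induction f arbitrary: w)
    case 0
    then show ?case using v by (simp add: mat_poly_vec_0)
  next
    case (pCons a f)
    note c = mat_poly_vec_carrier
    have Aw: "- (A *\<^sub>v w) \<in> carrier_vec n" using A pCons.prems by auto
    have "w \<bullet> mat_poly_vec A v (pCons a f) = a * (w \<bullet> v) + - (A *\<^sub>v w) \<bullet> mat_poly_vec A v f"
      using pCons.prems v A c[OF v, of f] pair[of w "mat_poly_vec A v f"]
      by (simp add: mat_poly_vec_pCons scalar_prod_add_distrib[of _ n])
    also have "\<dots> = a * (w \<bullet> v) + mat_poly_vec A (- (A *\<^sub>v w)) (reflect_arg f) \<bullet> v"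
      using pCons.IH[OF Aw] by simp
    also have "- (A *\<^sub>v w) = mat_poly_vec A w [:0, -1:]"
      using A pCons.prems by (auto simp: mat_poly_vec_linear intro!: eq_vecI)
    also have "mat_poly_vec A (mat_poly_vec A w [:0, -1:]) (reflect_arg f)
        = mat_poly_vec A w (pCons 0 (- reflect_arg f))"
      using pCons.prems by (simp flip: mat_poly_vec_mult)
    also have "a * (w \<bullet> v) + mat_poly_vec A w (pCons 0 (- reflect_arg f)) \<bullet> v
        = mat_poly_vec A w (pCons a (- reflect_arg f)) \<bullet> v"
      using pCons.prems v A c[OF pCons.prems, of "- reflect_arg f"]
      by (simp add: mat_poly_vec_pCons add_scalar_prod_distrib[of _ n])
    finally show ?case by (simp add: reflect_arg_pCons)
  qed
qed

end

section \<open>Divided differences under a linear functional\<close>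

text \<open>The image of \<open>(f(x) - f(y)) / (x - y)\<close> under a functional \<open>\<sigma>\<close> acting on the polynomials
  in \<open>y\<close>.\<close>

definition divided_diff :: "(int poly \<Rightarrow> int) \<Rightarrow> int poly \<Rightarrow> int poly" where
  "divided_diff \<sigma> f = Poly (map (\<lambda>i. \<sigma> (poly_shift (Suc i) f)) [0..<degree f])"

lemma poly_shift_Suc_pCons: "poly_shift (Suc i) (pCons a f) = poly_shift i f"
  by (simp add: poly_eq_iff coeff_poly_shift)

lemma poly_shift_eq_pCons: "poly_shift k f = pCons (coeff f k) (poly_shift (Suc k) f)"
  by (simp add: poly_eq_iff coeff_poly_shift coeff_pCons split: nat.split)

lemma poly_shift_eq_0: "degree f < k \<Longrightarrow> poly_shift k f = 0"
  by (simp add: poly_eq_iff coeff_poly_shift coeff_eq_0)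

lemma poly_shift_add: "poly_shift k (f + g) = poly_shift k f + (poly_shift k g :: int poly)"
  by (simp add: poly_eq_iff coeff_poly_shift)

lemma poly_shift_smult: "poly_shift k (smult a f) = smult a (poly_shift k f :: int poly)"
  by (simp add: poly_eq_iff coeff_poly_shift)

locale linear_functional =
  fixes \<sigma> :: "int poly \<Rightarrow> int"
  assumes add: "\<sigma> (f + g) = \<sigma> f + \<sigma> g"
    and smult: "\<sigma> (smult a f) = a * \<sigma> f"
begin

lemma zero [simp]: "\<sigma> 0 = 0"
  using smult[of 0 0] by simp

lemma uminus: "\<sigma> (- f) = - \<sigma> f"
  using smult[of "-1" f] by simp

lemma mult_left: "linear_functional (\<lambda>f. \<sigma> (g * f))"
  by unfold_locales (simp_all add: distrib_left add smult)

text \<open>(f(x) - f(y)) / (x - y) has \<open>poly_shift (Suc i) f\<close>, in the variable y, as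
  its coefficient of x^i; from i = \<open>degree f\<close> on these shifts vanish.\<close>

lemma coeff_divided_diff: "coeff (divided_diff \<sigma> f) i = \<sigma> (poly_shift (Suc i) f)"
  by (auto simp: divided_diff_def coeff_Poly nth_default_def poly_shift_eq_0)

lemma divided_diff_0 [simp]: "divided_diff \<sigma> 0 = 0"
  by (simp add: poly_eq_iff coeff_divided_diff)

lemma divided_diff_pCons: "divided_diff \<sigma> (pCons a f) = pCons (\<sigma> f) (divided_diff \<sigma> f)"
  by (simp add: poly_eq_iff coeff_divided_diff poly_shift_Suc_pCons coeff_pCons split: nat.split)

lemma divided_diff_add: "divided_diff \<sigma> (f + g) = divided_diff \<sigma> f + divided_diff \<sigma> g"
  by (simp add: poly_eq_iff coeff_divided_diff poly_shift_add add)

lemma divided_diff_smult: "divided_diff \<sigma> (smult a f) = smult a (divided_diff \<sigma> f)"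
  by (simp add: poly_eq_iff coeff_divided_diff poly_shift_smult smult)

lemma divided_diff_uminus: "divided_diff \<sigma> (- f) = - divided_diff \<sigma> f"
  using divided_diff_smult[of "-1" f] by simp

text \<open>f(x)g(x) - f(y)g(y) = f(x)(g(x) - g(y)) + (f(x) - f(y))g(y); the factor g(y) of the last
  term is absorbed into the functional.\<close>

lemma divided_diff_mult:
  "divided_diff \<sigma> (f * g) = f * divided_diff \<sigma> g + divided_diff (\<lambda>h. \<sigma> (g * h)) f"
proof (induction f)
  case 0
  interpret g: linear_functional "\<lambda>h. \<sigma> (g * h)" by (rule mult_left)
  show ?case by simp
next
  case (pCons a f)
  interpret g: linear_functional "\<lambda>h. \<sigma> (g * h)" by (rule mult_left)
  have "divided_diff \<sigma> (pCons a f * g)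
      = smult a (divided_diff \<sigma> g) + pCons (\<sigma> (f * g)) (divided_diff \<sigma> (f * g))"
    by (simp add: divided_diff_add divided_diff_smult divided_diff_pCons)
  also have "\<dots> = pCons a f * divided_diff \<sigma> g + pCons (\<sigma> (g * f)) (divided_diff (\<lambda>h. \<sigma> (g * h)) f)"
    by (simp add: pCons.IH mult.commute)
  finally show ?case by (simp add: g.divided_diff_pCons)
qed

lemma divided_diff_dvd:
  assumes "\<And>f. p dvd \<sigma> f"
  shows "[:p:] dvd divided_diff \<sigma> f"
  using assms by (simp add: const_poly_dvd_iff coeff_divided_diff)

lemma degree_divided_diff:
  assumes "divided_diff \<sigma> f \<noteq> 0"
  shows "degree (divided_diff \<sigma> f) < degree f"
proof (rule ccontr)
  assume "\<not> ?thesis"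
  then have "lead_coeff (divided_diff \<sigma> f) = 0" by (simp add: coeff_divided_diff poly_shift_eq_0)
  then show False using assms by simp
qed

text \<open>Replacing (x, y) by (-x, -y) changes the sign of x - y, while an even functional does
  not notice the sign of y.\<close>

lemma reflect_arg_divided_diff:
  assumes even: "\<And>f. \<sigma> (reflect_arg f) = \<sigma> f"
  shows "reflect_arg (divided_diff \<sigma> f) = - divided_diff \<sigma> (reflect_arg f)"
  by (induction f)
    (simp_all add: divided_diff_pCons reflect_arg_pCons divided_diff_uminus uminus even)

end


section \<open>The characteristic polynomial of a rank one perturbation\<close>

text \<open>The matrix determinant lemma without inverses: the determinant of \<open>A\<close>
  bordered by \<open>u\<close>, \<open>v\<close> and 1 is computed by two block eliminations, and
  the common factor \<open>det A\<close> is cancelled at the end.\<close>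

lemma det_minus_rank_one:
  fixes A :: "'a :: idom mat"
  assumes A: "A \<in> carrier_mat n n" and u: "u \<in> carrier_mat n 1" and v: "v \<in> carrier_mat 1 n"
    and det: "det A \<noteq> 0"
  shows "det (A - u * v) = det A - (v * (adj_mat A * u)) $$ (0, 0)"
proof -
  let ?M = "four_block_mat A u v (1\<^sub>m 1)"
  let ?P = "four_block_mat (1\<^sub>m n) (0\<^sub>m n 1) (- v) (1\<^sub>m 1)"
  let ?R = "four_block_mat (1\<^sub>m n) (- (adj_mat A * u)) (0\<^sub>m 1 n) (det A \<cdot>\<^sub>m 1\<^sub>m 1)"
  note adj = adj_mat[OF A]
  have M: "?M \<in> carrier_mat (n + 1) (n + 1)" "?P \<in> carrier_mat (n + 1) (n + 1)"
    "?R \<in> carrier_mat (n + 1) (n + 1)"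
    by (intro four_block_carrier_mat A; simp)+
  have au: "adj_mat A * u \<in> carrier_mat n 1" using adj(1) u by simp
  have vau: "v * (adj_mat A * u) \<in> carrier_mat 1 1" using au v by simp
  have mv: "- v \<in> carrier_mat 1 n" using v by simp
  have mau: "- (adj_mat A * u) \<in> carrier_mat n 1" using au by simp
  have "det (?M * ?P) = det (four_block_mat (A * 1\<^sub>m n + u * - v) (A * 0\<^sub>m n 1 + u * 1\<^sub>m 1)
      (v * 1\<^sub>m n + 1\<^sub>m 1 * - v) (v * 0\<^sub>m n 1 + 1\<^sub>m 1 * 1\<^sub>m 1))"
    by (subst mult_four_block_mat[OF A u v _ _ _ mv]) auto
  also have "A * 1\<^sub>m n + u * - v = A - u * v" using A u v by (intro eq_matI) auto
  also have "A * 0\<^sub>m n 1 + u * 1\<^sub>m 1 = u" using A u by (intro eq_matI) auto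
  also have "v * 1\<^sub>m n + 1\<^sub>m 1 * - v = 0\<^sub>m 1 n" using v by (intro eq_matI) auto
  also have "v * 0\<^sub>m n 1 + 1\<^sub>m 1 * 1\<^sub>m 1 = 1\<^sub>m 1" using v by (intro eq_matI) auto
  also have "det (four_block_mat (A - u * v) u (0\<^sub>m 1 n) (1\<^sub>m 1)) = det (A - u * v)"
    using det_four_block_mat_lower_left_zero[OF minus_carrier_mat u refl one_carrier_mat, of "u * v" A] u v
    by simp
  finally have "det (?M * ?P) = det (A - u * v)" .
  moreover have "det (?M * ?P) = det ?M * det ?P" using M by (intro det_mult)
  moreover have "det ?P = 1"
    using det_four_block_mat_upper_right_zero[OF one_carrier_mat refl mv one_carrier_mat] by simp
  ultimately have 1: "det ?M = det (A - u * v)" by simp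
  \<comment> \<open>\<open>?R\<close> clears the column \<open>u\<close> by \<open>adj_mat A\<close>
    in place of an inverse, at the cost of a factor \<open>det A\<close>.\<close>
  have "?M * ?R = four_block_mat (A * 1\<^sub>m n + u * 0\<^sub>m 1 n) (A * - (adj_mat A * u) + u * (det A \<cdot>\<^sub>m 1\<^sub>m 1))
      (v * 1\<^sub>m n + 1\<^sub>m 1 * 0\<^sub>m 1 n) (v * - (adj_mat A * u) + 1\<^sub>m 1 * (det A \<cdot>\<^sub>m 1\<^sub>m 1))"
    by (rule mult_four_block_mat[OF A u v _ _ mau]) auto
  also have "A * 1\<^sub>m n + u * 0\<^sub>m 1 n = A" using A u by (intro eq_matI) auto
  also have "A * - (adj_mat A * u) + u * (det A \<cdot>\<^sub>m 1\<^sub>m 1) = 0\<^sub>m n 1"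
  proof -
    have "A * - (adj_mat A * u) = - (A * (adj_mat A * u))" using A adj(1) by (simp add: uminus_mult_right_mat)
    also have "A * (adj_mat A * u) = (A * adj_mat A) * u" using A adj(1) u by simp
    also have "\<dots> = det A \<cdot>\<^sub>m u" unfolding adj(2) using u mult_smult_assoc_mat[OF one_carrier_mat u] by simp
    finally show ?thesis using u by (intro eq_matI) auto
  qed
  also have "v * 1\<^sub>m n + 1\<^sub>m 1 * 0\<^sub>m 1 n = v" using v by (intro eq_matI) auto
  finally have "det (?M * ?R) = det A * det (v * - (adj_mat A * u) + 1\<^sub>m 1 * (det A \<cdot>\<^sub>m 1\<^sub>m 1))"
    using det_four_block_mat_upper_right_zero[OF A refl v,
        of "v * - (adj_mat A * u) + 1\<^sub>m 1 * (det A \<cdot>\<^sub>m 1\<^sub>m 1)"] v mau by simp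
  also have "v * - (adj_mat A * u) = - (v * (adj_mat A * u))" using v adj(1) by (simp add: uminus_mult_right_mat)
  also have "det (- (v * (adj_mat A * u)) + 1\<^sub>m 1 * (det A \<cdot>\<^sub>m 1\<^sub>m 1))
      = det A - (v * (adj_mat A * u)) $$ (0, 0)"
    using carrier_matD[OF vau] by (subst det_single) (auto simp del: index_mult_mat(2,3))
  also have "det (?M * ?R) = det ?M * det ?R" using M by (intro det_mult)
  also have "det ?R = det A"
    using det_four_block_mat_lower_left_zero[OF one_carrier_mat mau refl, of "det A \<cdot>\<^sub>m 1\<^sub>m 1"]
    by (simp add: det_single)
  finally show ?thesis using det 1 by (simp add: mult.commute)
qed

lemma char_poly_matrix_index:
  assumes "A \<in> carrier_mat n n" "i < n" "j < n"
  shows "char_poly_matrix A $$ (i, j) = (if i = j then [:0, 1:] else 0) - [:A $$ (i, j):]"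
  using assms by (auto simp: char_poly_matrix_def)

text \<open>Horner's scheme: comparing coefficients in \<open>(x - A) u = \<chi>(x) v\<close> determines \<open>u\<close> and shows
  \<open>\<chi>(A) v = 0\<close>.\<close>

lemma char_poly_matrix_solution:
  assumes A: "A \<in> carrier_mat n n" and v: "v \<in> carrier_vec n" and u: "u \<in> carrier_vec n"
    and eq: "char_poly_matrix A *\<^sub>v u = f \<cdot>\<^sub>v map_vec (\<lambda>a. [:a:]) v"
  shows "\<And>i k. i < n \<Longrightarrow> coeff (u $ i) k = mat_poly_vec A v (poly_shift (Suc k) f) $ i"
    and "mat_poly_vec A v f = 0\<^sub>v n"
proof -
  have row: "pCons 0 (u $ i) - (\<Sum>j<n. smult (A $$ (i, j)) (u $ j)) = smult (v $ i) f" if i: "i < n" for i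
  proof -
    have "(char_poly_matrix A *\<^sub>v u) $ i
        = (\<Sum>j<n. ((if i = j then [:0, 1:] else 0) - [:A $$ (i, j):]) * u $ j)"
      using A u i carrier_matD[OF char_poly_matrix_closed[OF A]]
      by (simp add: scalar_prod_def char_poly_matrix_index lessThan_atLeast0)
    also have "\<dots> = (\<Sum>j<n. if i = j then pCons 0 (u $ j) else 0) - (\<Sum>j<n. smult (A $$ (i, j)) (u $ j))"
      unfolding sum_subtractf[symmetric] by (intro sum.cong) (auto simp: algebra_simps)
    also have "(\<Sum>j<n. if i = j then pCons 0 (u $ j) else 0) = pCons 0 (u $ i)"
      using i by simp
    finally show ?thesis using eq i v by (simp add: mult.commute)
  qed
  define w where "w k = vec n (\<lambda>i. coeff (u $ i) k)" for k
  have w: "w k \<in> carrier_vec n" for k by (simp add: w_def)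
  have Aw: "(A *\<^sub>v w k) $ i = (\<Sum>j<n. A $$ (i, j) * coeff (u $ j) k)" if "i < n" for i k
    using that A by (simp add: w_def scalar_prod_def lessThan_atLeast0)
  have step: "w k = coeff f (Suc k) \<cdot>\<^sub>v v + A *\<^sub>v w (Suc k)" for k
  proof (rule eq_vecI)
    fix i assume "i < dim_vec (coeff f (Suc k) \<cdot>\<^sub>v v + A *\<^sub>v w (Suc k))"
    then have i: "i < n" using A by simp
    have "coeff (pCons 0 (u $ i) - (\<Sum>j<n. smult (A $$ (i, j)) (u $ j))) (Suc k) = coeff (smult (v $ i) f) (Suc k)"
      using row[OF i] by simp
    then show "w k $ i = (coeff f (Suc k) \<cdot>\<^sub>v v + A *\<^sub>v w (Suc k)) $ i"
      using i A v Aw[OF i, of "Suc k"] by (simp add: w_def coeff_sum mult.commute)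
  qed (use A v in \<open>simp add: w_def\<close>)
  \<comment> \<open>Above \<open>N\<close> all coefficients of \<open>u\<close> and \<open>f\<close>
    vanish, so the recursion can be run downwards from there.\<close>
  define N where "N = Max (insert (degree f) ((\<lambda>i. degree (u $ i)) ` {..<n}))"
  have N: "degree f \<le> N" "\<And>i. i < n \<Longrightarrow> degree (u $ i) \<le> N" by (auto simp: N_def)
  have key: "w k = mat_poly_vec A v (poly_shift (Suc k) f)" for k
  proof (cases "k \<le> N")
    case False
    then have "w k = 0\<^sub>v n" using N by (auto simp: w_def intro!: eq_vecI coeff_eq_0)
      (meson coeff_eq_0 le_less_trans not_le)
    moreover have "poly_shift (Suc k) f = 0" using N(1) False by (intro poly_shift_eq_0) auto
    ultimately show ?thesis using A v by (simp add: mat_poly_vec_0)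
  next
    case True
    then show ?thesis
    proof (induction k rule: inc_induct)
      case base
      have "w (Suc N) = 0\<^sub>v n" using N by (auto simp: w_def intro!: eq_vecI coeff_eq_0 le_imp_less_Suc)
      moreover have "poly_shift (Suc N) f = 0" "coeff f (Suc N) = 0"
        using N(1) by (auto intro!: poly_shift_eq_0 coeff_eq_0)
      ultimately show ?case using step[of N] A v by (simp add: mat_poly_vec_0) (auto intro!: eq_vecI)
    next
      case (step k)
      have "poly_shift (Suc k) f = pCons (coeff f (Suc k)) (poly_shift (Suc (Suc k)) f)"
        by (rule poly_shift_eq_pCons)
      then show ?case using step.IH \<open>w k = coeff f (Suc k) \<cdot>\<^sub>v v + A *\<^sub>v w (Suc k)\<close> A v
        by (simp add: mat_poly_vec_pCons)
    qed
  qed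
  show "coeff (u $ i) k = mat_poly_vec A v (poly_shift (Suc k) f) $ i" if "i < n" for i k
    using key[of k] that by (metis w_def index_vec)
  \<comment> \<open>The constant coefficient of the same equation is the last Horner step and yields
    f(A) v.\<close>
  have "coeff f 0 \<cdot>\<^sub>v v + A *\<^sub>v w 0 = 0\<^sub>v n"
  proof (rule eq_vecI)
    fix i assume "i < dim_vec (0\<^sub>v n :: int vec)"
    then have i: "i < n" by simp
    have "coeff (pCons 0 (u $ i) - (\<Sum>j<n. smult (A $$ (i, j)) (u $ j))) 0 = coeff (smult (v $ i) f) 0"
      using row[OF i] by simp
    then show "(coeff f 0 \<cdot>\<^sub>v v + A *\<^sub>v w 0) $ i = 0\<^sub>v n $ i"
      using i A v Aw[OF i, of 0] by (simp add: coeff_sum mult.commute)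
  qed (use A v in simp)
  moreover have "f = pCons (coeff f 0) (poly_shift (Suc 0) f)"
    using poly_shift_eq_pCons[of 0 f] by simp
  ultimately show "mat_poly_vec A v f = 0\<^sub>v n"
    using key[of 0] A v mat_poly_vec_pCons by metis
qed

lemma adj_char_poly_matrix:
  assumes A: "A \<in> carrier_mat n n" and v: "v \<in> carrier_vec n"
  shows "char_poly_matrix A *\<^sub>v (adj_mat (char_poly_matrix A) *\<^sub>v map_vec (\<lambda>a. [:a:]) v)
    = char_poly A \<cdot>\<^sub>v map_vec (\<lambda>a. [:a:]) v"
proof -
  have C: "char_poly_matrix A \<in> carrier_mat n n" using A by simp
  have "char_poly_matrix A *\<^sub>v (adj_mat (char_poly_matrix A) *\<^sub>v map_vec (\<lambda>a. [:a:]) v)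
      = (char_poly_matrix A * adj_mat (char_poly_matrix A)) *\<^sub>v map_vec (\<lambda>a. [:a:]) v"
    using C adj_mat(1)[OF C] v by simp
  then show ?thesis unfolding adj_mat(2)[OF C] using v
    by (auto simp: char_poly_def intro!: eq_vecI)
qed

lemma cayley_hamilton_vec:
  assumes A: "A \<in> carrier_mat n n" and v: "v \<in> carrier_vec n"
  shows "mat_poly_vec A v (char_poly A) = 0\<^sub>v n"
  using char_poly_matrix_solution(2)[OF A v _ adj_char_poly_matrix[OF A v]]
    adj_mat(1)[OF char_poly_matrix_closed[OF A]] v by auto

lemma linear_functional_mat_poly_vec:
  assumes A: "A \<in> carrier_mat n n" and v: "v \<in> carrier_vec n" and w: "w \<in> carrier_vec n"
  shows "linear_functional (\<lambda>f. w \<bullet> mat_poly_vec A v f)"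
proof
  note c = mat_poly_vec_carrier[OF A v]
  show "w \<bullet> mat_poly_vec A v (f + g) = w \<bullet> mat_poly_vec A v f + w \<bullet> mat_poly_vec A v g" for f g
    unfolding mat_poly_vec_add[OF A v] by (rule scalar_prod_add_distrib[OF w c c])
  show "w \<bullet> mat_poly_vec A v (smult a f) = a * (w \<bullet> mat_poly_vec A v f)" for a f
    unfolding mat_poly_vec_smult[OF A v] by (rule scalar_prod_smult_distrib[OF w c])
qed

text \<open>The all-one matrix has rank one, so the two characteristic polynomials differ by e^T
  adj(x - A) e. By Horner's scheme the coefficient of x^k in adj(x - A) e is a shift of \<chi>
  evaluated at A and e, and pairing it with e gives a coefficient of the divided difference.\<close>

lemma char_poly_add_all_one:
  fixes A :: "int mat"
  assumes A: "A \<in> carrier_mat n n"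
  defines "e \<equiv> all_one_vec n"
  shows "char_poly (A + all_one_mat n)
    = char_poly A - divided_diff (\<lambda>f. e \<bullet> mat_poly_vec A e f) (char_poly A)"
proof -
  let ?C = "char_poly_matrix A"
  let ?e = "map_vec (\<lambda>a. [:a:]) e"
  let ?U = "mat n 1 (\<lambda>_. 1) :: int poly mat"
  let ?V = "mat 1 n (\<lambda>_. 1) :: int poly mat"
  define u where "u = adj_mat ?C *\<^sub>v ?e"
  have C: "?C \<in> carrier_mat n n" using A by simp
  note adj = adj_mat(1)[OF C]
  have e: "e \<in> carrier_vec n" by (simp add: e_def all_one_vec_def)
  have u: "u \<in> carrier_vec n" using adj e by (simp add: u_def)
  interpret linear_functional "\<lambda>f. e \<bullet> mat_poly_vec A e f"
    using A e e by (rule linear_functional_mat_poly_vec)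
  have const: "[:- a - 1:] = [:- a:] - 1" for a :: int
    by (rule poly_eqI) (simp add: coeff_pCons split: nat.split)
  have "char_poly_matrix (A + all_one_mat n) = ?C - ?U * ?V"
    using A by (intro eq_matI) (auto simp: char_poly_matrix_def all_one_mat_def scalar_prod_def const)
  moreover have "det ?C \<noteq> 0" using degree_monic_char_poly[OF A] by (auto simp: char_poly_def)
  ultimately have "char_poly (A + all_one_mat n) = char_poly A - (?V * (adj_mat ?C * ?U)) $$ (0, 0)"
    using det_minus_rank_one[OF C, of ?U ?V] by (simp add: char_poly_def)
  also have "(?V * (adj_mat ?C * ?U)) $$ (0, 0) = (\<Sum>i<n. u $ i)"
  proof -
    have "(adj_mat ?C * ?U) $$ (i, 0) = u $ i" if "i < n" for i
      using that adj unfolding u_def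
      by (simp add: scalar_prod_def e_def all_one_vec_def)
    then show ?thesis using adj by (simp add: scalar_prod_def lessThan_atLeast0)
  qed
  also have "\<dots> = divided_diff (\<lambda>f. e \<bullet> mat_poly_vec A e f) (char_poly A)"
  proof (rule poly_eqI)
    fix k
    have "coeff (\<Sum>i<n. u $ i) k = (\<Sum>i<n. mat_poly_vec A e (poly_shift (Suc k) (char_poly A)) $ i)"
      using char_poly_matrix_solution(1)[OF A e u] adj_char_poly_matrix[OF A e]
      by (simp add: coeff_sum u_def)
    also have "\<dots> = e \<bullet> mat_poly_vec A e (poly_shift (Suc k) (char_poly A))"
      using carrier_vecD[OF mat_poly_vec_carrier[OF A e, of "poly_shift (Suc k) (char_poly A)"]]
      by (simp add: scalar_prod_def e_def all_one_vec_def lessThan_atLeast0)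
    finally show "coeff (\<Sum>i<n. u $ i) k
        = coeff (divided_diff (\<lambda>f. e \<bullet> mat_poly_vec A e f) (char_poly A)) k"
      by (simp only: coeff_divided_diff)
  qed
  finally show ?thesis .
qed

section \<open>Counting vectors over a prime field\<close>

text \<open>Coordinates in a basis are a bijection, so over a finite field dimensions can be
  compared by counting, with no independent family to exhibit.\<close>

lemma (in vectorspace) card_carrier_eq_power_dim:
  assumes fin: "finite (carrier V)"
  shows "card (carrier V) = card (carrier K) ^ dim"
proof -
  have "span (carrier V) = carrier V"
    using in_own_span[of "carrier V"] span_is_subset2[of "carrier V"] by auto
  then have "fin_dim" unfolding fin_dim_def using fin by blast
  then obtain \<beta> where \<beta>: "finite \<beta>" "basis \<beta>" using finite_basis_exists by blast
  then have sub: "\<beta> \<subseteq> carrier V" by (simp add: basis_def)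
  have ex1: "\<exists>!a. a \<in> \<beta> \<rightarrow>\<^sub>E carrier K \<and> lincomb a \<beta> = v" if "v \<in> carrier V" for v
    using basis_criterion[OF \<beta>(1) sub] \<beta>(2) that by blast
  have "bij_betw (\<lambda>a. lincomb a \<beta>) (\<beta> \<rightarrow>\<^sub>E carrier K) (carrier V)"
    unfolding bij_betw_def inj_on_def
  proof (intro conjI ballI impI equalityI subsetI)
    fix a b assume ab: "a \<in> \<beta> \<rightarrow>\<^sub>E carrier K" "b \<in> \<beta> \<rightarrow>\<^sub>E carrier K" "lincomb a \<beta> = lincomb b \<beta>"
    have "lincomb a \<beta> \<in> carrier V" using ab(1) sub by (intro lincomb_closed) auto
    then show "a = b" using ex1 ab by metis
  next
    fix v assume "v \<in> (\<lambda>a. lincomb a \<beta>) ` (\<beta> \<rightarrow>\<^sub>E carrier K)"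
    then show "v \<in> carrier V" using sub by (auto intro!: lincomb_closed)
  next
    fix v assume "v \<in> carrier V"
    then show "v \<in> (\<lambda>a. lincomb a \<beta>) ` (\<beta> \<rightarrow>\<^sub>E carrier K)" using ex1[of v] by blast
  qed
  then have "card (carrier V) = card (\<beta> \<rightarrow>\<^sub>E carrier K)" by (simp add: bij_betw_same_card)
  also have "\<dots> = card (carrier K) ^ card \<beta>" using \<beta>(1) by (simp add: card_PiE)
  finally show ?thesis using dim_basis[OF \<beta>] by simp
qed

lemma carrier_residue_vecs_iff:
  assumes "p > 1"
  shows "v \<in> carrier (residue_vecs p n) \<longleftrightarrow> v \<in> carrier_vec n \<and> (\<forall>i<n. 0 \<le> v $ i \<and> v $ i < p)"
proof -
  have "x mod p = x \<longleftrightarrow> 0 \<le> x \<and> x < p" for x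
  proof
    assume "x mod p = x"
    then show "0 \<le> x \<and> x < p" using assms pos_mod_sign[of p x] pos_mod_bound[of p x] by linarith
  qed (simp add: mod_pos_pos_trivial)
  then show ?thesis by (auto simp: residue_vecs_def vec_mod_def vec_eq_iff)
qed

lemma vec_mod_eq_0_iff:
  "v \<in> carrier_vec n \<Longrightarrow> vec_mod p v = 0\<^sub>v n \<longleftrightarrow> (\<forall>i<n. p dvd v $ i)"
  by (auto simp: vec_mod_def vec_eq_iff dvd_eq_mod_eq_0)

lemma finite_residue_vecs:
  assumes "p > 1"
  shows "finite (carrier (residue_vecs p n))"
proof -
  have "inj_on (\<lambda>v. \<lambda>i\<in>{..<n}. v $ i) (carrier (residue_vecs p n))"
  proof (rule inj_onI)
    fix v w assume vw: "v \<in> carrier (residue_vecs p n)" "w \<in> carrier (residue_vecs p n)"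
      and eq: "(\<lambda>i\<in>{..<n}. v $ i) = (\<lambda>i\<in>{..<n}. w $ i)"
    have "v $ i = w $ i" if "i < n" for i using fun_cong[OF eq, of i] that by simp
    then show "v = w" using vw by (auto simp: carrier_residue_vecs_iff[OF assms])
  qed
  moreover have "(\<lambda>v. \<lambda>i\<in>{..<n}. v $ i) ` carrier (residue_vecs p n) \<subseteq> {..<n} \<rightarrow>\<^sub>E {0..<p}"
    by (auto simp: carrier_residue_vecs_iff[OF assms] split: if_splits)
  ultimately show ?thesis by (meson finite_PiE finite_atLeastLessThan_int finite_imageD finite_lessThan finite_subset)
qed

text \<open>An injective map from k-tuples of residues into the kernel gives it at least p^k
  elements; counting then bounds the dimension.\<close>

lemma nullity_mod_ge:
  fixes A :: "int mat"
  assumes p: "prime p" and A: "A \<in> carrier_mat m n"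
    and inj: "inj_on F ({..<k} \<rightarrow>\<^sub>E {0..<p})"
    and carr: "\<And>c. c \<in> {..<k} \<rightarrow>\<^sub>E {0..<p} \<Longrightarrow> F c \<in> carrier (residue_vecs p n)"
    and ker: "\<And>c i. c \<in> {..<k} \<rightarrow>\<^sub>E {0..<p} \<Longrightarrow> i < m \<Longrightarrow> p dvd (A *\<^sub>v F c) $ i"
  shows "k \<le> nullity_mod p A"
proof -
  have p1: "p > 1" using p by (rule prime_gt_1_int)
  interpret vectorspace "residue_ring p" "residue_vecs p n" by (rule vectorspace_residue_vecs[OF p])
  define N where "N = {v \<in> carrier (residue_vecs p n). vec_mod p (A *\<^sub>v v) = 0\<^sub>v m}"
  have N: "v \<in> N \<longleftrightarrow> v \<in> carrier (residue_vecs p n) \<and> (\<forall>i<m. p dvd row A i \<bullet> v)" for v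
  proof -
    have "v \<in> carrier (residue_vecs p n) \<Longrightarrow> A *\<^sub>v v \<in> carrier_vec m"
      using A by (simp add: carrier_residue_vecs_iff[OF p1])
    then show ?thesis using A by (auto simp: N_def vec_mod_eq_0_iff)
  qed
  \<comment> \<open>The operations of \<open>residue_vecs\<close> reduce their results, so the
    kernel condition must be insensitive to reduction.\<close>
  have dvd_mod: "p dvd row A i \<bullet> vec_mod p v \<longleftrightarrow> p dvd row A i \<bullet> v" if "v \<in> carrier_vec n" for i v
  proof -
    have "(row A i \<bullet> vec_mod p v) mod p = (\<Sum>j<n. row A i $ j * (v $ j mod p)) mod p"
      using that by (simp add: scalar_prod_def vec_mod_def lessThan_atLeast0)
    also have "\<dots> = (\<Sum>j<n. row A i $ j * v $ j) mod p"
      by (subst (1 2) mod_sum_eq[symmetric]) (simp add: mod_mult_right_eq)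
    also have "\<dots> = (row A i \<bullet> v) mod p"
      using that by (simp add: scalar_prod_def lessThan_atLeast0)
    finally show ?thesis by (simp add: dvd_eq_mod_eq_0)
  qed
  have rowA: "row A i \<in> carrier_vec n" for i using A by auto
  have "submodule (residue_ring p) N (residue_vecs p n)"
  proof (unfold_locales)
    show "N \<subseteq> carrier (residue_vecs p n)" by (auto simp: N_def)
  next
    fix v w assume vw: "v \<in> N" "w \<in> N"
    have c: "v \<in> carrier_vec n" "w \<in> carrier_vec n"
      using vw by (auto simp: N carrier_residue_vecs_iff[OF p1])
    have "p dvd row A i \<bullet> (v + w)" if "i < m" for i
      using vw that by (simp add: scalar_prod_add_distrib[OF rowA c] N)
    then have "p dvd row A i \<bullet> vec_mod p (v + w)" if "i < m" for i
      using dvd_mod[of "v + w" i] c that by simp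
    moreover have "v \<oplus>\<^bsub>residue_vecs p n\<^esub> w = vec_mod p (v + w)" by (simp add: residue_vecs_def)
    moreover have "v \<oplus>\<^bsub>residue_vecs p n\<^esub> w \<in> carrier (residue_vecs p n)"
      using vw by (intro a_closed) (auto simp: N)
    ultimately show "v \<oplus>\<^bsub>residue_vecs p n\<^esub> w \<in> N" by (simp add: N)
  next
    have "\<zero>\<^bsub>residue_vecs p n\<^esub> = 0\<^sub>v n" by (simp add: residue_vecs_def)
    then show "\<zero>\<^bsub>residue_vecs p n\<^esub> \<in> N"
      using rowA p1 by (simp add: N carrier_residue_vecs_iff[OF p1])
  next
    fix c v assume cv: "c \<in> carrier (residue_ring p)" "v \<in> N"
    have v: "v \<in> carrier_vec n" using cv by (auto simp: N carrier_residue_vecs_iff[OF p1])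
    have "p dvd row A i \<bullet> (c \<cdot>\<^sub>v v)" if "i < m" for i
      using cv that by (simp add: scalar_prod_smult_distrib[OF rowA v] N)
    then have "p dvd row A i \<bullet> vec_mod p (c \<cdot>\<^sub>v v)" if "i < m" for i
      using dvd_mod[of "c \<cdot>\<^sub>v v" i] v that by simp
    moreover have "c \<odot>\<^bsub>residue_vecs p n\<^esub> v = vec_mod p (c \<cdot>\<^sub>v v)" by (simp add: residue_vecs_def)
    moreover have "c \<odot>\<^bsub>residue_vecs p n\<^esub> v \<in> carrier (residue_vecs p n)"
      using cv by (intro smult_closed) (auto simp: N)
    ultimately show "c \<odot>\<^bsub>residue_vecs p n\<^esub> v \<in> N" by (simp add: N)
  qed
  then have "subspace (residue_ring p) N (residue_vecs p n)"
    using vectorspace_residue_vecs[OF p] by (simp add: subspace_def)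
  then interpret N: vectorspace "residue_ring p" "(residue_vecs p n)\<lparr>carrier := N\<rparr>"
    by (rule subspace_is_vs)
  have finN: "finite N" using finite_residue_vecs[OF p1] by (auto simp: N_def)
  have nullity: "nullity_mod p A = N.dim" using A by (simp add: nullity_mod_def N_def)
  have "card (carrier (residue_ring p)) = nat p" using p1 by (simp add: residue_ring_def)
  then have "card N = nat p ^ N.dim" using N.card_carrier_eq_power_dim finN by simp
  moreover have "F ` ({..<k} \<rightarrow>\<^sub>E {0..<p}) \<subseteq> N" using carr ker A by (auto simp: N)
  then have "card ({..<k} \<rightarrow>\<^sub>E {0..<p}) \<le> card N" by (rule card_inj_on_le[OF inj _ finN])
  ultimately have "nat p ^ k \<le> nat p ^ N.dim" by (simp add: card_PiE)
  then show ?thesis using p1 nullity by (simp add: power_increasing_iff)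
qed

section \<open>Irreducibility under reflection and change of sign\<close>

context prime_modulus
begin

text \<open>x -> -x is an involutive ring automorphism, so a factorization of f(-x) reflects to one
  of \<open>f\<close>.\<close>

lemma irreducible_m_reflect_arg:
  assumes "irreducible_m f"
  shows "irreducible_m (reflect_arg f)"
  unfolding irreducible_m_def
proof (intro conjI allI impI)
  show "\<not> reflect_arg f =m 0"
    using reflect_arg_eq_m[of "reflect_arg f" 0] irreducible_m_not_0[OF assms] by auto
  show "\<not> reflect_arg f dvdm 1"
    using reflect_arg_dvdm[of "reflect_arg f" 1] irreducible_m_not_unit[OF assms] by (auto simp: pcompose_1)
  fix a b assume "reflect_arg f =m a * b"
  then have "f =m reflect_arg a * reflect_arg b"
    using reflect_arg_eq_m[of "reflect_arg f" "a * b"] by (simp add: pcompose_mult)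
  then have "reflect_arg a dvdm 1 \<or> reflect_arg b dvdm 1" by (rule irreducible_mD[OF assms])
  then show "a dvdm 1 \<or> b dvdm 1"
    using reflect_arg_dvdm[of "reflect_arg a" 1] reflect_arg_dvdm[of "reflect_arg b" 1]
    by (auto simp: pcompose_1)
qed

lemma smult_sign_dvdm:
  assumes "s * s = 1"
  shows "smult s f dvdm f" "f dvdm smult s f"
  using dvdm_triv_left[of "smult s f" "[:s:]"] dvdm_triv_left[of f "[:s:]"] assms
  by (simp_all add: mult.commute[of _ "[:s:]"])

lemma irreducible_m_smult_sign:
  assumes "s * s = 1" "irreducible_m f"
  shows "irreducible_m (smult s f)"
  unfolding irreducible_m_def
proof (intro conjI allI impI)
  have ff: "f = smult s (smult s f)" using assms(1) by simp
  show "\<not> smult s f =m 0"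
  proof
    assume "smult s f =m 0"
    then have "[:s:] * smult s f =m [:s:] * 0" by (intro eq_m_mult refl)
    then show False using irreducible_m_not_0[OF assms(2)] ff by simp
  qed
  show "\<not> smult s f dvdm 1"
    using irreducible_m_not_unit[OF assms(2)] smult_sign_dvdm[OF assms(1), of f] dvdm_trans by blast
  fix a b assume "smult s f =m a * b"
  then have "[:s:] * smult s f =m [:s:] * (a * b)" by (intro eq_m_mult refl)
  then have "f =m smult s a * b" using ff by simp
  then have "smult s a dvdm 1 \<or> b dvdm 1" by (rule irreducible_mD[OF assms(2)])
  then show "a dvdm 1 \<or> b dvdm 1" using smult_sign_dvdm[OF assms(1), of a] dvdm_trans by blast
qed

lemma prod_dvdm_mono:
  assumes "\<And>q. q \<in> F \<Longrightarrow> f q dvdm g q"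
  shows "prod f F dvdm prod g F"
  using assms
proof (induction F rule: infinite_finite_induct)
  case (insert q F)
  then show ?case by (simp add: dvdm_mult_mono)
qed simp_all

end

section \<open>Walks generated by a skew-symmetric matrix\<close>

text \<open>\<open>walk f\<close> is \<open>f(S) e\<close>. The two final assumptions express that \<open>e, S e, \<dots>, S\<^bsup>n-1\<^esup> e\<close> are linearly
  independent and that \<open>d\<close> annihilates the quotient of \<open>\<int>\<^sup>n\<close> by the lattice they span.\<close>

locale skew_walks =
  fixes n :: nat and S :: "int mat" and e :: "int vec" and d :: int
  assumes S: "S \<in> carrier_mat n n" and skew: "transpose_mat S = - S" and e: "e \<in> carrier_vec n"
    and indep: "mat_poly_vec S e f = 0\<^sub>v n \<Longrightarrow> degree f < n \<Longrightarrow> f = 0"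
    and gen: "y \<in> carrier_vec n \<Longrightarrow> \<exists>f. mat_poly_vec S e f = d \<cdot>\<^sub>v y"
begin

abbreviation walk :: "int poly \<Rightarrow> int vec" where
  "walk \<equiv> mat_poly_vec S e"

abbreviation moment :: "int poly \<Rightarrow> int" where
  "moment f \<equiv> e \<bullet> walk f"

sublocale moment: linear_functional moment
  by (rule linear_functional_mat_poly_vec[OF S e e])

lemma walk_carrier: "walk f \<in> carrier_vec n"
  by (rule mat_poly_vec_carrier[OF S e])

lemma walk_char_poly_mult: "walk (f * char_poly S) = 0\<^sub>v n" "walk (char_poly S * f) = 0\<^sub>v n"
proof -
  have "walk (char_poly S * f) = mat_poly_vec S (walk f) (char_poly S)"
    by (rule mat_poly_vec_mult[OF S e])
  also have "\<dots> = 0\<^sub>v n" by (rule cayley_hamilton_vec[OF S walk_carrier])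
  finally show "walk (char_poly S * f) = 0\<^sub>v n" .
  then show "walk (f * char_poly S) = 0\<^sub>v n" by (simp only: mult.commute)
qed

text \<open>Moving S across the pairing of \<open>e\<close> with f(S) e gives f(-S) e: the moment
  functional is even.\<close>

lemma moment_reflect_arg: "moment (reflect_arg f) = moment f"
proof -
  have "moment f = walk (reflect_arg f) \<bullet> e" by (rule mat_poly_vec_pairing[OF S skew e e])
  also have "\<dots> = moment (reflect_arg f)" by (rule comm_scalar_prod[OF walk_carrier e])
  finally show ?thesis by simp
qed

text \<open>The difference of the two sides has degree below \<open>n\<close> and annihilates
  \<open>e\<close>; independence makes it zero.\<close>

lemma reflect_arg_char_poly: "reflect_arg (char_poly S) = smult ((-1) ^ n) (char_poly S)"
proof -
  have chi: "degree (char_poly S) = n" "coeff (char_poly S) n = 1"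
    using degree_monic_char_poly[OF S] by auto
  define g where "g = reflect_arg (char_poly S) - smult ((-1) ^ n) (char_poly S)"
  \<comment> \<open>Pairing with a unit vector moves the polynomial there and undoes the reflection,
    so Cayley-Hamilton applies to the unit vector.\<close>
  have "walk (reflect_arg (char_poly S)) = 0\<^sub>v n"
  proof (rule eq_vecI)
    fix i assume "i < dim_vec (0\<^sub>v n :: int vec)"
    then have i: "i < n" by simp
    have u: "unit_vec n i \<in> carrier_vec n" by simp
    have "walk (reflect_arg (char_poly S)) $ i = unit_vec n i \<bullet> walk (reflect_arg (char_poly S))"
      using i walk_carrier by (simp add: scalar_prod_left_unit)
    also have "\<dots> = mat_poly_vec S (unit_vec n i) (reflect_arg (reflect_arg (char_poly S))) \<bullet> e"
      by (rule mat_poly_vec_pairing[OF S skew e u])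
    also have "\<dots> = 0\<^sub>v n \<bullet> e" by (simp only: reflect_arg_reflect_arg cayley_hamilton_vec[OF S u])
    finally show "walk (reflect_arg (char_poly S)) $ i = 0\<^sub>v n $ i" using i e by simp
  qed (simp add: carrier_vecD[OF walk_carrier])
  moreover have "walk (smult ((-1) ^ n) (char_poly S)) = 0\<^sub>v n"
    using walk_char_poly_mult(1)[of "[:(-1) ^ n:]"] by simp
  ultimately have "walk g = 0\<^sub>v n" unfolding g_def
    by (simp add: mat_poly_vec_add[OF S e] mat_poly_vec_uminus[OF S e] diff_conv_add_uminus
        del: add_uminus_conv_diff)
  moreover have "coeff g n = 0" using chi by (simp add: g_def coeff_reflect_arg)
  have "degree g \<le> n" unfolding g_def using chi(1)
    by (intro degree_diff_le) (auto intro: order_trans[OF degree_smult_le])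
  then have "g = 0 \<or> degree g < n"
    using \<open>coeff g n = 0\<close> by (metis le_neq_implies_less leading_coeff_0_iff)
  ultimately have "g = 0" using indep by blast
  then show ?thesis by (simp add: g_def)
qed

lemma reflect_arg_moment_char_poly:
  "reflect_arg (divided_diff moment (char_poly S))
    = smult (- ((-1) ^ n)) (divided_diff moment (char_poly S))"
  by (simp add: moment.reflect_arg_divided_diff[OF moment_reflect_arg] reflect_arg_char_poly
      moment.divided_diff_smult)

end

section \<open>Reduction modulo a prime divisor of \<open>d\<close>\<close>

text \<open>Here \<open>m\<close> is the minimal polynomial of \<open>e\<close> with respect to \<open>S\<close> over the field with \<open>p\<close> elements.\<close>

locale skew_walks_mod = skew_walks n S e d + prime_modulus p for n S e d p +
  fixes m h :: "int poly"
  assumes p_dvd_d: "p dvd d" and m: "monic_mod p m"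
    and m_iff: "(\<forall>i<n. p dvd mat_poly_vec S e f $ i) \<longleftrightarrow> m dvdm f"
    and mh: "char_poly S =m m * h" and h_fixed: "Mp h = h"
begin

abbreviation bezoutian :: "int poly \<Rightarrow> int poly" where
  "bezoutian \<equiv> divided_diff moment"

lemma m_monic: "monic m" and m_fixed: "Mp m = m"
  using m by (simp_all add: monic_mod_def)

lemma m_not_0: "\<not> m =m 0"
  using m_monic by (simp add: eq_m_0_iff_dvd[simplified] Mp_eq_0_iff_dvd monic_not_const_p_dvd)

lemma p_dvd_scalar_prod:
  assumes "\<forall>i<n. p dvd v $ i" "v \<in> carrier_vec n" "w \<in> carrier_vec n"
  shows "p dvd w \<bullet> v" "p dvd v \<bullet> w"
  using assms by (auto simp: scalar_prod_def intro!: dvd_sum)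

lemma p_dvd_moment: "m dvdm f \<Longrightarrow> p dvd moment f"
  using m_iff[of f] walk_carrier e by (intro p_dvd_scalar_prod) auto

lemma bezoutian_eq_m:
  assumes "f =m g"
  shows "bezoutian f =m bezoutian g"
proof -
  obtain w where w: "f - g = [:p:] * w" using assms by (auto simp: eq_m_iff_dvd elim: dvdE)
  have "bezoutian f - bezoutian g = bezoutian (f + - g)"
    by (simp only: moment.divided_diff_add moment.divided_diff_uminus diff_conv_add_uminus)
  also have "\<dots> = smult p (bezoutian w)" using w by (simp add: moment.divided_diff_smult)
  finally show ?thesis by (simp add: eq_m_iff_dvd const_poly_dvd_iff)
qed

text \<open>By the product rule for \<chi> = h m, what is left over is a divided difference of
  \<open>h\<close> under the functional f -> moment(m f), whose values are divisible by
  \<open>p\<close> because m(S) e vanishes modulo \<open>p\<close>.\<close>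

lemma bezoutian_char_poly: "bezoutian (char_poly S) =m h * bezoutian m"
proof -
  have "bezoutian (char_poly S) =m bezoutian (h * m)"
    using mh by (intro bezoutian_eq_m) (simp add: mult.commute)
  also have "bezoutian (h * m) = h * bezoutian m + divided_diff (\<lambda>f. moment (m * f)) h"
    by (rule moment.divided_diff_mult)
  finally have *: "bezoutian (char_poly S) =m h * bezoutian m + divided_diff (\<lambda>f. moment (m * f)) h" .
  interpret M: linear_functional "\<lambda>f. moment (m * f)" by (rule moment.mult_left)
  have "divided_diff (\<lambda>f. moment (m * f)) h =m 0"
    unfolding eq_m_0_iff_dvd by (intro M.divided_diff_dvd p_dvd_moment dvdm_triv_left)
  then have "h * bezoutian m + divided_diff (\<lambda>f. moment (m * f)) h =m h * bezoutian m + 0"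
    by (intro eq_m_add refl)
  with * show ?thesis by simp
qed

lemma degree_h: "degree m + degree h = n" and h_not_0: "h \<noteq> 0"
proof -
  have chi: "degree (char_poly S) = n" "monic (char_poly S)"
    using degree_monic_char_poly[OF S] by auto
  show "h \<noteq> 0"
  proof
    assume "h = 0"
    then have "char_poly S =m 0" using mh by simp
    then show False using monic_not_const_p_dvd[OF chi(2)] by (simp only: eq_m_0_iff_dvd)
  qed
  then have "degree (Mp (m * h)) = degree m + degree h"
    using degree_Mp_mult[OF m_monic h_fixed] by blast
  moreover have "degree (Mp (char_poly S)) = n" using monic_mod_Mp(2)[OF chi(2)] chi(1) by simp
  ultimately show "degree m + degree h = n" using mh by metis
qed

text \<open>Write d y = f(S) e. Then \<open>m\<close> divides \<open>f\<close>, so h f is a multiple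
  of \<chi> modulo \<open>p\<close> and d h(S) y = p w(S) e. Pairing with \<open>z\<close> brings a
  second factor \<open>p\<close>, of which \<open>d\<close> can absorb only one.\<close>

lemma h_annihilates_mod:
  assumes p2: "\<not> p * p dvd d" and y: "y \<in> carrier_vec n" and z: "z \<in> carrier_vec n"
    and orth: "\<And>f. p dvd z \<bullet> walk f"
  shows "p dvd z \<bullet> mat_poly_vec S y h"
proof -
  obtain f where f: "walk f = d \<cdot>\<^sub>v y" using gen[OF y] by blast
  have "m dvdm f" using p_dvd_d y unfolding m_iff[symmetric] f by auto
  then obtain g where g: "f =m m * g" unfolding dvdm_def by blast
  have "h * f =m h * (m * g)" using g by (intro eq_m_mult refl)
  moreover have "char_poly S * g =m m * h * g" using mh by (intro eq_m_mult refl)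
  ultimately have "h * f =m char_poly S * g" by (simp add: ac_simps)
  then obtain w where w: "h * f - char_poly S * g = [:p:] * w" by (auto simp: eq_m_iff_dvd elim: dvdE)
  then have hf: "h * f = char_poly S * g + smult p w" by (simp add: algebra_simps)
  have "walk (h * f) = 0\<^sub>v n + p \<cdot>\<^sub>v walk w"
    unfolding hf mat_poly_vec_add[OF S e] mat_poly_vec_smult[OF S e] walk_char_poly_mult(2) ..
  also have "\<dots> = p \<cdot>\<^sub>v walk w" using walk_carrier by simp
  finally have 1: "walk (h * f) = p \<cdot>\<^sub>v walk w" .
  have "walk (h * f) = mat_poly_vec S (mat_poly_vec S y [:d:]) h"
    by (simp only: mat_poly_vec_mult[OF S e] f mat_poly_vec_const[OF S y])
  also have "\<dots> = mat_poly_vec S y (smult d h)"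
    by (simp flip: mat_poly_vec_mult[OF S y])
  also have "\<dots> = d \<cdot>\<^sub>v mat_poly_vec S y h" by (rule mat_poly_vec_smult[OF S y])
  finally have "d \<cdot>\<^sub>v mat_poly_vec S y h = p \<cdot>\<^sub>v walk w" using 1 by simp
  then have "d * (z \<bullet> mat_poly_vec S y h) = p * (z \<bullet> walk w)"
    using scalar_prod_smult_distrib[OF z mat_poly_vec_carrier[OF S y]]
      scalar_prod_smult_distrib[OF z walk_carrier] by metis
  moreover obtain k where "z \<bullet> walk w = p * k" using orth by (auto elim: dvdE)
  ultimately have eq: "d * (z \<bullet> mat_poly_vec S y h) = p * p * k" by simp
  obtain d' where d': "d = p * d'" using p_dvd_d by (rule dvdE)
  have "\<not> p dvd d'" using p2 d' by auto
  moreover have "d' * (z \<bullet> mat_poly_vec S y h) = p * k" using eq d' p_gt_1 by simp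
  ultimately show ?thesis using prime_dvd_mult_iff[OF prime_p] by (metis dvd_triv_left)
qed

text \<open>If neither holds, \<phi> divides \<open>m\<close> and the Bezoutian of \<open>m\<close>.
  With m = \<phi> m1 the vector m1(S) e is then orthogonal to everything modulo \<open>p\<close>,
  hence zero, which contradicts the minimality of \<open>m\<close>.\<close>

lemma common_factor_dvdm:
  assumes p2: "\<not> p * p dvd d"
    and phi: "irreducible_m \<phi>" "monic \<phi>" "\<phi> dvdm char_poly S" "\<phi> dvdm bezoutian (char_poly S)"
  shows "\<phi> dvdm h \<or> reflect_arg \<phi> dvdm h"
proof (rule ccontr)
  assume neg: "\<not> (\<phi> dvdm h \<or> reflect_arg \<phi> dvdm h)"
  have "\<phi> dvdm h * bezoutian m" using phi(4) bezoutian_char_poly by (rule dvdm_eq_m_trans)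
  then have R: "\<phi> dvdm bezoutian m" using irreducible_mod_prime[OF phi(1)] neg by blast
  have "\<phi> dvdm h * m" using dvdm_eq_m_trans[OF phi(3) mh] by (simp only: mult.commute)
  then have "\<phi> dvdm m" using irreducible_mod_prime[OF phi(1)] neg by blast
  then obtain m1 where m1: "m =m \<phi> * m1" unfolding dvdm_def by blast
  have m_dvd: "m dvdm f * \<phi> * m1" for f
  proof -
    have "f * m =m f * (\<phi> * m1)" using m1 by (intro eq_m_mult refl)
    then show ?thesis using dvdm_eq_m_trans[of m "f * m"] by (simp add: mult.assoc)
  qed
  interpret m1: linear_functional "\<lambda>f. moment (m1 * f)" by (rule moment.mult_left)
  let ?D = "divided_diff (\<lambda>f. moment (m1 * f))"
  have "bezoutian m =m \<phi> * bezoutian m1 + ?D \<phi>"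
    using bezoutian_eq_m[OF m1] by (simp only: moment.divided_diff_mult)
  then have "\<phi> dvdm \<phi> * bezoutian m1 + ?D \<phi>" using R dvdm_eq_m_trans by blast
  then have "\<phi> dvdm (\<phi> * bezoutian m1 + ?D \<phi>) - \<phi> * bezoutian m1" by (intro dvdm_diff) simp_all
  then have phiD: "\<phi> dvdm ?D \<phi>" by simp
  \<comment> \<open>\<phi> divides this polynomial, whose degree would be smaller than that of
    \<phi>.\<close>
  have D0: "?D \<phi> =m 0"
  proof (rule ccontr)
    assume "\<not> ?D \<phi> =m 0"
    then have nz: "Mp (?D \<phi>) \<noteq> 0" by simp
    then have "degree \<phi> \<le> degree (Mp (?D \<phi>))" using phiD phi(2) by (intro dvdm_degree_le) simp_all
    also have "\<dots> \<le> degree (?D \<phi>)" by (rule degree_m_le)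
    also have "\<dots> < degree \<phi>" using nz by (intro m1.degree_divided_diff) auto
    finally show False by simp
  qed
  have orth: "p dvd moment (m1 * f)" for f
  proof -
    define a where "a = degree \<phi>"
    have "a > 0"
    proof (rule ccontr)
      assume "\<not> a > 0"
      then have "\<phi> = 1" using phi(2) a_def by (metis monic_degree_0 not_gr_zero)
      then show False using irreducible_m_not_unit[OF phi(1)] by simp
    qed
    \<comment> \<open>Dividing x^a f by \<phi> realizes \<open>f\<close> as the \<open>a\<close>-th
      shift of a multiple of \<phi>: the shift discards the remainder, whose degree is below
      \<open>a\<close>.\<close>
    obtain q r where qr: "monom 1 a * f = \<phi> * q + r" "r = 0 \<or> degree r < degree \<phi>"
      using monic_division[OF phi(2)] by blast
    have "poly_shift a (monom 1 a * f) = f"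
      by (simp add: poly_eq_iff coeff_poly_shift coeff_monom_mult)
    moreover have "poly_shift a r = 0" using qr(2) poly_shift_eq_0 a_def by auto
    ultimately have shift: "poly_shift a (q * \<phi>) = f"
      using qr(1) by (simp add: poly_shift_add mult.commute)
    have "?D (q * \<phi>) = q * ?D \<phi> + divided_diff (\<lambda>h. moment (m1 * (\<phi> * h))) q"
      by (rule m1.divided_diff_mult)
    moreover have "[:p:] dvd q * ?D \<phi>" using D0 by (simp only: eq_m_0_iff_dvd dvd_mult)
    moreover have "[:p:] dvd divided_diff (\<lambda>h. moment (m1 * (\<phi> * h))) q"
    proof (rule linear_functional.divided_diff_dvd[OF m1.mult_left])
      show "p dvd moment (m1 * (\<phi> * f))" for f
        using p_dvd_moment[OF m_dvd[of f]] by (simp add: ac_simps)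
    qed
    ultimately have "[:p:] dvd ?D (q * \<phi>)" by (simp only: dvd_add)
    \<comment> \<open>The coefficient with index a - 1 is the one that involves the shift by
      \<open>a\<close>, which is \<open>f\<close>.\<close>
    then have "p dvd coeff (?D (q * \<phi>)) (a - 1)" by (simp only: const_poly_dvd_iff)
    then show ?thesis using \<open>a > 0\<close> shift by (simp add: m1.coeff_divided_diff)
  qed
  define z where "z = walk m1"
  have z: "z \<in> carrier_vec n" using walk_carrier z_def by simp
  have z_walk: "p dvd z \<bullet> walk f" for f
  proof -
    have "z \<bullet> walk f = mat_poly_vec S z (reflect_arg f) \<bullet> e" by (rule mat_poly_vec_pairing[OF S skew e z])
    also have "\<dots> = walk (reflect_arg f * m1) \<bullet> e"
      unfolding z_def by (simp only: mat_poly_vec_mult[OF S e])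
    also have "\<dots> = moment (m1 * reflect_arg f)"
      by (simp only: comm_scalar_prod[OF walk_carrier e] mult.commute)
    finally show ?thesis using orth by simp
  qed
  \<comment> \<open>Modulo \<open>p\<close>, \<open>z\<close> is orthogonal to the images of
    \<phi>(-S) and of h(S); as \<phi>(-x) and \<open>h\<close> are coprime, these images together
    span all vectors.\<close>
  obtain u v where uv: "1 =m u * reflect_arg \<phi> + v * h"
    using irreducible_mod_bezout[OF irreducible_m_reflect_arg[OF phi(1)], of h] neg by blast
  have zy: "p dvd z \<bullet> y" if y: "y \<in> carrier_vec n" for y
  proof -
    interpret y: linear_functional "\<lambda>f. z \<bullet> mat_poly_vec S y f"
      by (rule linear_functional_mat_poly_vec[OF S y z])
    obtain w where w: "1 - (u * reflect_arg \<phi> + v * h) = [:p:] * w"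
      using uv by (auto simp: eq_m_iff_dvd elim: dvdE)
    have "p dvd z \<bullet> mat_poly_vec S y (u * reflect_arg \<phi>)"
    proof -
      have "z \<bullet> mat_poly_vec S y (u * reflect_arg \<phi>)
          = mat_poly_vec S z (reflect_arg (u * reflect_arg \<phi>)) \<bullet> y"
        by (rule mat_poly_vec_pairing[OF S skew y z])
      also have "\<dots> = walk (reflect_arg u * \<phi> * m1) \<bullet> y"
        unfolding z_def by (simp only: mat_poly_vec_mult[OF S e] pcompose_mult reflect_arg_reflect_arg)
      finally show ?thesis using m_dvd[of "reflect_arg u"] y walk_carrier
        by (simp only: flip: m_iff) (rule p_dvd_scalar_prod(2), auto)
    qed
    moreover have "p dvd z \<bullet> mat_poly_vec S y (v * h)"
    proof -
      have "mat_poly_vec S y (v * h) = mat_poly_vec S (mat_poly_vec S y v) h"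
        by (simp only: mat_poly_vec_mult[OF S y, symmetric] mult.commute)
      then show ?thesis
        using h_annihilates_mod[OF p2 mat_poly_vec_carrier[OF S y] z z_walk] by simp
    qed
    moreover have "z \<bullet> mat_poly_vec S y 1 = z \<bullet> mat_poly_vec S y (u * reflect_arg \<phi>)
        + z \<bullet> mat_poly_vec S y (v * h) + p * (z \<bullet> mat_poly_vec S y w)"
    proof -
      have "1 = u * reflect_arg \<phi> + v * h + smult p w" using w by (simp add: algebra_simps)
      then show ?thesis using y.add y.smult by metis
    qed
    ultimately have "p dvd z \<bullet> mat_poly_vec S y 1" by simp
    then show ?thesis by (simp only: mat_poly_vec_1[OF S y])
  qed
  have "p dvd z $ i" if "i < n" for i
    using zy[of "unit_vec n i"] that z by (simp add: scalar_prod_right_unit)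
  then have "m dvdm m1" unfolding m_iff[symmetric] z_def[symmetric] by blast
  \<comment> \<open>From m1 = m t and m = \<phi> m1, cancelling \<open>m1\<close> turns \<phi> into
    a unit.\<close>
  then obtain t where t: "m1 =m m * t" unfolding dvdm_def by blast
  have "m * t =m \<phi> * m1 * t" using m1 by (intro eq_m_mult refl)
  then have "m1 * 1 =m m1 * (\<phi> * t)" using t by (simp add: ac_simps)
  moreover have "\<not> m1 =m 0"
  proof
    assume "m1 =m 0"
    then have "\<phi> * m1 =m \<phi> * 0" by (intro eq_m_mult refl)
    then show False using m1 m_not_0 by simp
  qed
  ultimately have "1 =m \<phi> * t" by (rule eq_m_cancel_left)
  then have "\<phi> dvdm 1" unfolding dvdm_def by blast
  then show False using irreducible_m_not_unit[OF phi(1)] by blast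
qed

text \<open>The symmetric factors in \<open>F\<close> all divide \<open>h\<close>, and the degree
  bound leaves room only for a unit besides them. So h(-x) divides h(x), and cancelling h(-x) in
  \<chi>(-x) = \<plusminus>\<chi>(x) transfers the symmetry to \<open>m\<close>.\<close>

lemma m_dvdm_reflect_arg:
  assumes p2: "\<not> p * p dvd d"
    and F: "finite F" "\<And>q. q \<in> F \<Longrightarrow> monic_irreducible_mod p q"
    and F_dvd: "\<And>q. q \<in> F \<Longrightarrow> q dvdm char_poly S" "\<And>q. q \<in> F \<Longrightarrow> q dvdm bezoutian (char_poly S)"
    and sym: "\<And>q. q \<in> F \<Longrightarrow> q dvdm reflect_arg q"
    and deg: "n - degree m \<le> degree (\<Prod>F)"
  shows "m dvdm reflect_arg m"
proof -
  have monic: "monic (\<Prod>F)" using F(2) by (intro monic_prod) (auto simp: monic_irreducible_mod_def monic_mod_def)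
  have "q dvdm h" if q: "q \<in> F" for q
    using common_factor_dvdm[OF p2, of q] F(2)[OF q] F_dvd[OF q] sym[OF q] dvdm_trans
    unfolding monic_irreducible_mod_def monic_mod_def by blast
  then have Ph: "\<Prod>F dvdm h" by (intro prod_dvdm F)
  then obtain t where t: "h =m \<Prod>F * t" "Mp t = t" by (rule dvdmE)
  have "t \<noteq> 0" using t(1) h_fixed h_not_0 by auto
  then have "degree (Mp (\<Prod>F * t)) = degree (\<Prod>F) + degree t" by (rule degree_Mp_mult[OF monic t(2)])
  then have "degree h = degree (\<Prod>F) + degree t" using t(1) h_fixed by metis
  then have "degree t = 0" using deg degree_h by simp
  then have "t dvdm 1" using Mp_fixed_unit t(2) \<open>t \<noteq> 0\<close> by blast
  then have hP: "h dvdm \<Prod>F" using dvdm_left_if_unit t(1) by blast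
  have "reflect_arg h dvdm reflect_arg (\<Prod>F)" using hP by (rule reflect_arg_dvdm)
  also have "reflect_arg (\<Prod>F) = (\<Prod>q\<in>F. reflect_arg q)" by (rule pcompose_prod)
  finally have "reflect_arg h dvdm (\<Prod>q\<in>F. reflect_arg q)" .
  moreover have "(\<Prod>q\<in>F. reflect_arg q) dvdm \<Prod>F"
  proof (rule prod_dvdm_mono)
    show "reflect_arg q dvdm q" if "q \<in> F" for q using reflect_arg_dvdm[OF sym[OF that]] by simp
  qed
  ultimately have "reflect_arg h dvdm h" using Ph dvdm_trans by blast
  then obtain s where s: "h =m reflect_arg h * s" unfolding dvdm_def by blast
  have "reflect_arg (char_poly S) =m reflect_arg m * reflect_arg h"
    using reflect_arg_eq_m[OF mh] by (simp only: pcompose_mult)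
  then have "reflect_arg h * reflect_arg m =m smult ((-1) ^ n) (char_poly S)"
    by (simp only: reflect_arg_char_poly mult.commute)
  also have "smult ((-1) ^ n) (char_poly S) = [:(-1) ^ n:] * char_poly S" by simp
  also have "[:(-1) ^ n:] * char_poly S =m [:(-1) ^ n:] * (m * h)" using mh by (intro eq_m_mult refl)
  also have "[:(-1) ^ n:] * (m * h) =m [:(-1) ^ n:] * (m * (reflect_arg h * s))"
    using s by (intro eq_m_mult refl)
  also have "[:(-1) ^ n:] * (m * (reflect_arg h * s)) = reflect_arg h * (m * ([:(-1) ^ n:] * s))"
    by (simp only: ac_simps)
  finally have "reflect_arg h * reflect_arg m =m reflect_arg h * (m * ([:(-1) ^ n:] * s))" .
  moreover have "\<not> reflect_arg h =m 0"
    using reflect_arg_eq_m[of "reflect_arg h" 0] h_not_0 h_fixed by auto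
  ultimately have "reflect_arg m =m m * ([:(-1) ^ n:] * s)" by (rule eq_m_cancel_left)
  then show ?thesis unfolding dvdm_def by blast
qed

end

section \<open>Minimal polynomials modulo primes and the integral reflection\<close>

context skew_walks
begin

text \<open>The polynomials that annihilate \<open>e\<close> modulo \<open>p\<close> form an ideal;
  it contains \<chi>, which is monic and hence nonzero modulo \<open>p\<close>, so
  \<open>ideal_generator\<close> applies.\<close>

lemma minimal_polynomial_mod:
  assumes p: "prime p" and pd: "p dvd d"
  shows "\<exists>m h. skew_walks_mod n S e d p m h"
proof -
  interpret prime_modulus p by unfold_locales (rule p)
  define I where "I = {f. \<forall>i<n. p dvd walk f $ i}"
  have chi: "monic (char_poly S)" using degree_monic_char_poly[OF S] by auto
  have "\<exists>m. monic_mod p m \<and> m \<in> I \<and> (\<forall>f\<in>I. m dvdm f)"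
  proof (rule ideal_generator[of I "char_poly S"])
    show "f + g \<in> I" if "f \<in> I" "g \<in> I" for f g
      using that carrier_vecD[OF walk_carrier] by (simp add: I_def mat_poly_vec_add[OF S e])
    show "g * f \<in> I" if "f \<in> I" for f g
      using that mat_poly_vec_dvd_mult[OF S e] by (simp add: I_def)
    show "[:p:] \<in> I" using mat_poly_vec_dvd[OF S e, of p "[:p:]"] by (simp add: I_def)
    show "char_poly S \<in> I" using cayley_hamilton_vec[OF S e] by (simp add: I_def)
    show "\<not> [:p:] dvd char_poly S" by (rule monic_not_const_p_dvd[OF chi])
  qed blast
  then obtain m where m: "monic_mod p m" "m \<in> I" "\<And>f. f \<in> I \<Longrightarrow> m dvdm f" by blast
  have m_iff: "(\<forall>i<n. p dvd walk f $ i) \<longleftrightarrow> m dvdm f" for f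
  proof
    assume "m dvdm f"
    then obtain g w where "f - m * g = [:p:] * w" by (auto simp: dvdm_iff_dvd elim: dvdE)
    then have f: "f = g * m + [:p:] * w" by (simp add: algebra_simps)
    have "p dvd walk (g * m) $ i" "p dvd walk ([:p:] * w) $ i" if "i < n" for i
      using m(2) that mat_poly_vec_dvd_mult[OF S e, of p m i g] mat_poly_vec_dvd[OF S e _ that, of p "[:p:] * w"]
      by (simp_all only: I_def mem_Collect_eq dvd_triv_left)
    then show "\<forall>i<n. p dvd walk f $ i"
      unfolding f mat_poly_vec_add[OF S e]
      using carrier_vecD[OF walk_carrier] by (simp del: mult_pCons_left)
  qed (use m(3) in \<open>simp add: I_def\<close>)
  have "m dvdm char_poly S" using cayley_hamilton_vec[OF S e] by (simp flip: m_iff)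
  then obtain h where "char_poly S =m m * h" "Mp h = h" by (rule dvdmE)
  then have "skew_walks_mod n S e d p m h" using p pd m(1) m_iff by unfold_locales
  then show ?thesis by blast
qed

text \<open>Pairing with d times a unit vector, written as g(S) e, moves f(-S) over as f(S), and (f
  g)(S) e = 0. This makes f(S) e -> f(-S) e well defined.\<close>

lemma walk_reflect_arg_eq_0:
  assumes d: "d \<noteq> 0" and f: "walk f = 0\<^sub>v n"
  shows "walk (reflect_arg f) = 0\<^sub>v n"
proof (rule eq_vecI)
  fix i assume "i < dim_vec (0\<^sub>v n :: int vec)"
  then have i: "i < n" by simp
  obtain g where g: "walk g = d \<cdot>\<^sub>v unit_vec n i" using gen[of "unit_vec n i"] by auto
  have "d * walk (reflect_arg f) $ i = walk g \<bullet> walk (reflect_arg f)"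
    using i smult_scalar_prod_distrib[OF unit_vec_carrier walk_carrier, of d i "reflect_arg f"]
      scalar_prod_left_unit[OF walk_carrier i]
    by (simp only: g)
  also have "\<dots> = mat_poly_vec S (walk g) (reflect_arg (reflect_arg f)) \<bullet> e"
    by (rule mat_poly_vec_pairing[OF S skew e walk_carrier])
  also have "\<dots> = mat_poly_vec S (walk f) g \<bullet> e"
    by (simp only: reflect_arg_reflect_arg mat_poly_vec_mult[OF S e, symmetric] mult.commute)
  also have "mat_poly_vec S (walk f) g = walk (0 * g)"
    by (simp only: mat_poly_vec_mult[OF S e] f mult.commute[of 0] mat_poly_vec_0[OF S e])
  also have "\<dots> \<bullet> e = 0" using e by (simp add: mat_poly_vec_0[OF S e])
  finally show "walk (reflect_arg f) $ i = 0\<^sub>v n $ i" using d i by simp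
qed (simp add: carrier_vecD[OF walk_carrier])

text \<open>The reflection \<open>f(S) e \<mapsto> f(-S) e\<close> is a rational orthogonal involution; the divisibility
  hypothesis makes it integral.\<close>

lemma integral_reflection:
  assumes d: "d \<noteq> 0"
    and dvd: "\<And>f. (\<And>i. i < n \<Longrightarrow> d dvd walk f $ i) \<Longrightarrow> (\<And>i. i < n \<Longrightarrow> d dvd walk (reflect_arg f) $ i)"
  obtains q where "\<And>y. y \<in> carrier_vec n \<Longrightarrow> q y \<in> carrier_vec n"
    "\<And>y f. y \<in> carrier_vec n \<Longrightarrow> walk f = d \<cdot>\<^sub>v y \<Longrightarrow> walk (reflect_arg f) = d \<cdot>\<^sub>v q y"
proof -
  have "\<exists>z \<in> carrier_vec n. \<forall>f. walk f = d \<cdot>\<^sub>v y \<longrightarrow> walk (reflect_arg f) = d \<cdot>\<^sub>v z"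
    if y: "y \<in> carrier_vec n" for y
  proof -
    obtain f where f: "walk f = d \<cdot>\<^sub>v y" using gen[OF y] by blast
    define z where "z = vec n (\<lambda>i. walk (reflect_arg f) $ i div d)"
    have "d dvd walk (reflect_arg f) $ i" if "i < n" for i
      using dvd[of f i] that y by (simp add: f)
    then have z: "walk (reflect_arg f) = d \<cdot>\<^sub>v z"
      by (intro eq_vecI) (simp_all add: z_def carrier_vecD[OF walk_carrier])
    \<comment> \<open>The value does not depend on the representative: two of them differ by a
      polynomial that annihilates \<open>e\<close>.\<close>
    have "walk (reflect_arg g) = d \<cdot>\<^sub>v z" if g: "walk g = d \<cdot>\<^sub>v y" for g
    proof -
      have "walk (g + - f) = 0\<^sub>v n"
        using y by (simp only: mat_poly_vec_add[OF S e] mat_poly_vec_uminus[OF S e] f g) auto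
      then have "walk (reflect_arg (g + - f)) = 0\<^sub>v n" by (rule walk_reflect_arg_eq_0[OF d])
      then have "walk (reflect_arg g) + - walk (reflect_arg f) = 0\<^sub>v n"
        by (simp only: pcompose_add pcompose_uminus mat_poly_vec_add[OF S e] mat_poly_vec_uminus[OF S e])
      then have "walk (reflect_arg g) = walk (reflect_arg f)"
        using carrier_vecD[OF walk_carrier] by (auto simp: vec_eq_iff)
      then show ?thesis using z by simp
    qed
    then show ?thesis by (intro bexI[of _ z]) (auto simp: z_def)
  qed
  then obtain q where "\<And>y. y \<in> carrier_vec n \<Longrightarrow>
      q y \<in> carrier_vec n \<and> (\<forall>f. walk f = d \<cdot>\<^sub>v y \<longrightarrow> walk (reflect_arg f) = d \<cdot>\<^sub>v q y)"
    by (metis (no_types, lifting))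
  then show thesis using that by blast
qed

end

text \<open>The sum of x^2 - x over the entries is zero, and each term is nonnegative for integers;
  so all entries are 0 or 1, and exactly one of them is 1.\<close>

lemma int_vec_eq_unit_vec:
  fixes v :: "int vec"
  assumes v: "v \<in> carrier_vec n" and norm: "v \<bullet> v = 1" and sum: "all_one_vec n \<bullet> v = 1"
  shows "\<exists>i<n. v = unit_vec n i"
proof -
  have s1: "(\<Sum>i<n. v $ i) = 1" and s2: "(\<Sum>i<n. v $ i * v $ i) = 1"
    using v norm sum by (simp_all add: scalar_prod_def all_one_vec_def lessThan_atLeast0)
  have "(\<Sum>i<n. v $ i * v $ i - v $ i) = 0" by (simp add: sum_subtractf s1 s2)
  moreover have nonneg: "0 \<le> x * x - x" for x :: int
  proof (cases "x \<ge> 1")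
    case True
    then have "x * 1 \<le> x * x" by (intro mult_left_mono) auto
    then show ?thesis by simp
  next
    case False
    then show ?thesis using zero_le_square[of x] by linarith
  qed
  ultimately have "\<forall>i\<in>{..<n}. v $ i * v $ i - v $ i = 0"
    by (subst (asm) sum_nonneg_eq_0_iff) auto
  then have v01: "v $ i = 0 \<or> v $ i = 1" if "i < n" for i
    using that by (simp add: algebra_simps)
  have "\<exists>i<n. v $ i \<noteq> 0"
    using s1 by (metis lessThan_iff sum.neutral zero_neq_one)
  then obtain i where i: "i < n" "v $ i = 1" using v01 by blast
  have "v $ j = 0" if j: "j < n" "j \<noteq> i" for j
  proof (rule ccontr)
    assume "v $ j \<noteq> 0"
    have "(\<Sum>k\<in>{i, j}. v $ k) \<le> (\<Sum>k<n. v $ k)"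
      using i j v01 by (intro sum_mono2) force+
    then show False using s1 i j v01[OF j(1)] \<open>v $ j \<noteq> 0\<close> by simp
  qed
  then have "v = unit_vec n i" using i v by (intro eq_vecI) auto
  then show ?thesis using i(1) by blast
qed

text \<open>The reflection \<open>q\<close> is integral, orthogonal and fixes the all-one vector, so
  it sends each unit vector to an integer vector of norm 1 and coordinate sum 1, again a unit
  vector. Anticommuting with \<open>S\<close> becomes the sign change of entries under
  \<pi>.\<close>

lemma (in skew_walks) skew_involution:
  assumes d: "d \<noteq> 0" and e1: "e = all_one_vec n"
    and dvd: "\<And>f. (\<And>i. i < n \<Longrightarrow> d dvd walk f $ i) \<Longrightarrow> (\<And>i. i < n \<Longrightarrow> d dvd walk (reflect_arg f) $ i)"
  obtains \<pi> where "\<And>j. j < n \<Longrightarrow> \<pi> j < n" "\<And>j. j < n \<Longrightarrow> \<pi> (\<pi> j) = j"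
    "\<And>i j. i < n \<Longrightarrow> j < n \<Longrightarrow> S $$ (\<pi> i, \<pi> j) = - S $$ (i, j)"
proof -
  obtain q where q: "\<And>y. y \<in> carrier_vec n \<Longrightarrow> q y \<in> carrier_vec n"
    and q_walk: "\<And>y f. y \<in> carrier_vec n \<Longrightarrow> walk f = d \<cdot>\<^sub>v y \<Longrightarrow> walk (reflect_arg f) = d \<cdot>\<^sub>v q y"
    using integral_reflection[OF d dvd] by blast
  have cancel: "y = z" if "d \<cdot>\<^sub>v y = d \<cdot>\<^sub>v z" "y \<in> carrier_vec n" "z \<in> carrier_vec n" for y z :: "int vec"
    using that d by (auto simp: vec_eq_iff)
  have q_eqI: "q y = z" if "y \<in> carrier_vec n" "z \<in> carrier_vec n" "walk f = d \<cdot>\<^sub>v y"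
    "walk (reflect_arg f) = d \<cdot>\<^sub>v z" for y z f
    by (rule cancel[OF _ q[OF that(1)] that(2)]) (simp only: q_walk[OF that(1,3), symmetric] that(4))
  have qe: "q e = e"
  proof (rule q_eqI[OF e e])
    show "walk [:d:] = d \<cdot>\<^sub>v e" by (rule mat_poly_vec_const[OF S e])
    then show "walk (reflect_arg [:d:]) = d \<cdot>\<^sub>v e" by simp
  qed
  have qq: "q (q y) = y" if y: "y \<in> carrier_vec n" for y
  proof -
    obtain f where f: "walk f = d \<cdot>\<^sub>v y" using gen[OF y] by blast
    show ?thesis by (rule q_eqI[OF q[OF y] y q_walk[OF y f]]) (simp add: f)
  qed
  have qS: "q (S *\<^sub>v y) = - (S *\<^sub>v q y)" if y: "y \<in> carrier_vec n" for y
  proof -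
    obtain f where f: "walk f = d \<cdot>\<^sub>v y" using gen[OF y] by blast
    \<comment> \<open>Multiplication by x represents \<open>S\<close>; reflecting x is what produces
      the minus sign.\<close>
    have "walk (pCons 0 f) = d \<cdot>\<^sub>v (S *\<^sub>v y)"
      using S e y by (auto simp: mat_poly_vec_pCons[OF S e] f mult_mat_smult_vec intro!: eq_vecI)
    moreover have "walk (reflect_arg (pCons 0 f)) = d \<cdot>\<^sub>v (- (S *\<^sub>v q y))"
    proof -
      have "walk (reflect_arg (pCons 0 f)) = - walk (pCons 0 (reflect_arg f))"
        by (simp add: reflect_arg_pCons flip: mat_poly_vec_uminus[OF S e])
      also have "walk (pCons 0 (reflect_arg f)) = d \<cdot>\<^sub>v (S *\<^sub>v q y)"
        using S e q[OF y]
        by (auto simp: mat_poly_vec_pCons[OF S e] q_walk[OF y f] mult_mat_smult_vec intro!: eq_vecI)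
      finally show ?thesis by auto
    qed
    ultimately show ?thesis using S y q[OF y] by (intro q_eqI) auto
  qed
  \<comment> \<open>Scalar products of walks are moments, and reflecting both factors reflects the
    polynomial under an even functional; this gives orthogonality.\<close>
  have walk_prod: "walk f \<bullet> walk g = moment (reflect_arg g * f)" for f g
  proof -
    have "walk f \<bullet> walk g = mat_poly_vec S (walk f) (reflect_arg g) \<bullet> e"
      by (rule mat_poly_vec_pairing[OF S skew e walk_carrier])
    also have "\<dots> = walk (reflect_arg g * f) \<bullet> e" by (simp only: mat_poly_vec_mult[OF S e])
    finally show ?thesis by (simp only: comm_scalar_prod[OF walk_carrier e])
  qed
  have orth: "q y \<bullet> q z = y \<bullet> z" if y: "y \<in> carrier_vec n" and z: "z \<in> carrier_vec n" for y z
  proof -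
    obtain f g where f: "walk f = d \<cdot>\<^sub>v y" and g: "walk g = d \<cdot>\<^sub>v z" using gen y z by metis
    have "walk (reflect_arg f) \<bullet> walk (reflect_arg g) = moment (reflect_arg (reflect_arg g * f))"
      by (simp only: walk_prod pcompose_mult)
    also have "\<dots> = walk f \<bullet> walk g" by (simp only: moment_reflect_arg walk_prod)
    finally have "(d \<cdot>\<^sub>v q y) \<bullet> (d \<cdot>\<^sub>v q z) = (d \<cdot>\<^sub>v y) \<bullet> (d \<cdot>\<^sub>v z)"
      by (simp only: q_walk[OF y f] q_walk[OF z g] f g)
    then have "d * (d * (q y \<bullet> q z)) = d * (d * (y \<bullet> z))"
      using y z q[OF y] q[OF z] by (simp add: scalar_prod_smult_distrib[of _ n] smult_scalar_prod_distrib[of _ n])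
    then show ?thesis using d by simp
  qed
  have unit: "unit_vec n j \<in> carrier_vec n" for j by simp
  have "\<exists>i<n. q (unit_vec n j) = unit_vec n i" if j: "j < n" for j
  proof (rule int_vec_eq_unit_vec)
    show "q (unit_vec n j) \<in> carrier_vec n" by (rule q[OF unit])
    show "q (unit_vec n j) \<bullet> q (unit_vec n j) = 1" using j by (simp add: orth[OF unit unit])
    have "e \<bullet> q (unit_vec n j) = e \<bullet> unit_vec n j" using orth[OF e unit, of j] by (simp only: qe)
    also have "\<dots> = 1" using j by (simp add: e1 all_one_vec_def)
    finally show "all_one_vec n \<bullet> q (unit_vec n j) = 1" by (simp only: e1)
  qed
  then obtain \<pi> where \<pi>: "\<And>j. j < n \<Longrightarrow> \<pi> j < n" "\<And>j. j < n \<Longrightarrow> q (unit_vec n j) = unit_vec n (\<pi> j)"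
    by metis
  have "\<pi> (\<pi> j) = j" if j: "j < n" for j
  proof -
    have "unit_vec n (\<pi> (\<pi> j)) = (unit_vec n j :: int vec)"
      using qq[OF unit, of j] \<pi> j by metis
    then have "unit_vec n (\<pi> (\<pi> j)) $ j = (unit_vec n j :: int vec) $ j" by simp
    then show ?thesis using j \<pi> by (auto split: if_splits)
  qed
  moreover have "S $$ (\<pi> i, \<pi> j) = - S $$ (i, j)" if i: "i < n" and j: "j < n" for i j
  proof -
    have entry: "S $$ (k, l) = unit_vec n k \<bullet> (S *\<^sub>v unit_vec n l)" if "k < n" "l < n" for k l
      using that S by simp
    have Su: "S *\<^sub>v unit_vec n j \<in> carrier_vec n" using S by simp
    have "S $$ (\<pi> i, \<pi> j) = q (unit_vec n i) \<bullet> (S *\<^sub>v q (unit_vec n j))"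
      using entry[OF \<pi>(1)[OF i] \<pi>(1)[OF j]] by (simp only: \<pi>(2)[OF i] \<pi>(2)[OF j])
    also have "S *\<^sub>v q (unit_vec n j) = - q (S *\<^sub>v unit_vec n j)"
      using qS[OF unit, of j] S q[OF unit, of j] by auto
    also have "q (unit_vec n i) \<bullet> - q (S *\<^sub>v unit_vec n j) = - (q (unit_vec n i) \<bullet> q (S *\<^sub>v unit_vec n j))"
      using q[OF unit, of i] q[OF Su] by simp
    also have "\<dots> = - S $$ (i, j)" using orth[OF unit Su] entry[OF i j] by simp
    finally show ?thesis .
  qed
  ultimately show thesis using that \<pi>(1) by blast
qed

context skew_walks_mod
begin

text \<open>Both \<open>\<chi>\<close> and its Bezoutian are invariant under \<open>x \<mapsto> -x\<close> up to sign, so the reflection of a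
  common factor is a common factor; coprimality forces the two to coincide.\<close>

lemma common_factor_symmetric:
  defines "F \<equiv> {q. monic_irreducible_mod p q \<and> q dvdm char_poly S \<and> q dvdm bezoutian (char_poly S)}"
  assumes coprime: "\<And>q q'. q \<in> F \<Longrightarrow> q' \<in> F \<Longrightarrow> q \<noteq> q' \<Longrightarrow> gcd_mod p q (reflect_arg q') = 1"
    and q: "q \<in> F"
  shows "q dvdm reflect_arg q"
proof -
  \<comment> \<open>The leading coefficient of q(-x) is this sign; multiplying by it makes the
    reflected factor monic again.\<close>
  define s :: int where "s = (-1) ^ degree q"
  have s: "s * s = 1" by (simp add: s_def flip: power_add)
  have irr: "irreducible_m q" and monic: "monic q" using q by (auto simp: F_def monic_irreducible_mod_def monic_mod_def)
  define q' where "q' = Mp (smult s (reflect_arg q))"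
  have lc: "monic (smult s (reflect_arg q))" using monic s by (simp add: coeff_reflect_arg s_def)
  have q'_eq: "q' =m smult s (reflect_arg q)" by (simp add: q'_def)
  have "irreducible_m (smult s (reflect_arg q))"
    using irreducible_m_smult_sign[OF s] irreducible_m_reflect_arg[OF irr] by blast
  then have "monic_irreducible_mod p q'"
    unfolding monic_irreducible_mod_def q'_def irreducible_m_Mp using monic_mod_Mp(1)[OF lc] by blast
  moreover have "q' dvdm reflect_arg q" unfolding q'_def Mp_dvdm by (rule smult_sign_dvdm(1)[OF s])
  have "q' dvdm char_poly S"
  proof -
    have "reflect_arg q dvdm smult ((-1) ^ n) (char_poly S)"
      using reflect_arg_dvdm[of q "char_poly S"] q by (simp add: F_def reflect_arg_char_poly)
    then show ?thesis using \<open>q' dvdm reflect_arg q\<close> smult_sign_dvdm(1)[of "(-1) ^ n" "char_poly S"] dvdm_trans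
      by (metis power_minus1_even power_add mult_2)
  qed
  moreover have "q' dvdm bezoutian (char_poly S)"
  proof -
    have "reflect_arg q dvdm smult (- ((-1) ^ n)) (bezoutian (char_poly S))"
      using reflect_arg_dvdm[of q "bezoutian (char_poly S)"] q
      by (simp only: F_def mem_Collect_eq reflect_arg_moment_char_poly)
    moreover have "smult (- ((-1) ^ n)) (bezoutian (char_poly S)) dvdm bezoutian (char_poly S)"
      by (rule smult_sign_dvdm(1)) (simp flip: power_add mult_2)
    ultimately show ?thesis using \<open>q' dvdm reflect_arg q\<close> dvdm_trans by blast
  qed
  ultimately have q'F: "q' \<in> F" by (simp add: F_def)
  have "q = q'"
  proof (rule ccontr)
    assume "q \<noteq> q'"
    then have "gcd_mod p q (reflect_arg q') = 1" using coprime q q'F by blast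
    \<comment> \<open>Reflecting twice gives back \<open>q\<close> up to sign, so a gcd equal to 1
      would make \<open>q\<close> a unit.\<close>
    moreover have "q dvdm reflect_arg q'"
    proof -
      have "reflect_arg q' =m smult s q"
        using reflect_arg_eq_m[OF q'_eq] by (simp add: pcompose_smult)
      then show ?thesis using smult_sign_dvdm(2)[OF s, of q] dvdm_eq_m_trans[of q "smult s q"] by simp
    qed
    ultimately have "q dvdm 1"
      using gcd_mod_spec(4)[OF irreducible_m_not_0[OF irr] dvdm_refl, of "reflect_arg q'"] by metis
    then show False using irreducible_m_not_unit[OF irr] by blast
  qed
  then show ?thesis using q'_def \<open>q' dvdm reflect_arg q\<close> by simp
qed

end

lemma poly_eq_sum_monom_lessThan:
  assumes "\<And>i. i \<ge> n \<Longrightarrow> coeff f i = 0"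
  shows "f = (\<Sum>k<n. monom (coeff f k) k)"
  using assms by (auto simp: poly_eq_iff coeff_sum not_less)

section \<open>The skew-walk matrix of an oriented graph\<close>

lemma smult_one_mat_mult_vec:
  fixes v :: "'a :: comm_ring_1 vec"
  assumes "v \<in> carrier_vec n"
  shows "(k \<cdot>\<^sub>m 1\<^sub>m n) *\<^sub>v v = k \<cdot>\<^sub>v v"
  using assms by (intro eq_vecI) auto

lemma all_one_vec_carrier [simp]: "all_one_vec n \<in> carrier_vec n"
  by (simp add: all_one_vec_def)

lemma skew_adjacency_carrier [simp]: "skew_adjacency n G \<in> carrier_mat n n"
  by (simp add: skew_adjacency_def)

lemma transpose_skew_adjacency:
  assumes "oriented_graph G"
  shows "transpose_mat (skew_adjacency n G) = - skew_adjacency n G"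
  using oriented_graph.one_direction[OF assms] by (intro eq_matI) (auto simp: skew_adjacency_def)

lemma skew_walk_carrier [simp]: "skew_walk n G \<in> carrier_mat n n"
  using mat_of_cols_carrier(1)[of n "map (\<lambda>k. (skew_adjacency n G ^\<^sub>m k) *\<^sub>v all_one_vec n) [0..<n]"]
  by (simp add: skew_walk_def)

text \<open>Identifies coefficient vectors of length \<open>n\<close> with polynomials of degree
  below \<open>n\<close>, on which the walk matrix acts by evaluation.\<close>

lemma skew_walk_mult_vec:
  assumes c: "c \<in> carrier_vec n"
  shows "skew_walk n G *\<^sub>v c
    = mat_poly_vec (skew_adjacency n G) (all_one_vec n) (\<Sum>k<n. monom (c $ k) k)"
proof (rule eq_vecI)
  let ?S = "skew_adjacency n G" and ?e = "all_one_vec n"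
  note dims = skew_adjacency_carrier[of n G] all_one_vec_carrier[of n]
  show "dim_vec (skew_walk n G *\<^sub>v c) = dim_vec (mat_poly_vec ?S ?e (\<Sum>k<n. monom (c $ k) k))"
    using mat_poly_vec_dim[OF dims] by (simp add: skew_walk_def)
  fix i assume "i < dim_vec (mat_poly_vec ?S ?e (\<Sum>k<n. monom (c $ k) k))"
  then have i: "i < n" using mat_poly_vec_dim[OF dims] by simp
  have W: "skew_walk n G $$ (i, k) = ((?S ^\<^sub>m k) *\<^sub>v ?e) $ i" if "k < n" for k
    using i that by (simp add: skew_walk_def mat_of_cols_index)
  have summand: "mat_poly_vec ?S ?e (monom (c $ k) k) $ i = skew_walk n G $$ (i, k) * c $ k" if "k < n" for k
  proof -
    have "mat_poly_vec ?S ?e (smult (c $ k) (monom 1 k)) = c $ k \<cdot>\<^sub>v ((?S ^\<^sub>m k) *\<^sub>v ?e)"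
      unfolding mat_poly_vec_smult[OF dims] mat_poly_vec_monom[OF dims] ..
    then show ?thesis using i that W[OF that] by (simp add: smult_monom skew_adjacency_def)
  qed
  have "(skew_walk n G *\<^sub>v c) $ i = (\<Sum>k<n. skew_walk n G $$ (i, k) * c $ k)"
    using i c carrier_matD[OF skew_walk_carrier] by (simp add: scalar_prod_def lessThan_atLeast0)
  also have "\<dots> = mat_poly_vec ?S ?e (\<Sum>k<n. monom (c $ k) k) $ i"
    unfolding mat_poly_vec_sum_index[OF dims finite_lessThan i] by (intro sum.cong) (simp_all add: summand)
  finally show "(skew_walk n G *\<^sub>v c) $ i = mat_poly_vec ?S ?e (\<Sum>k<n. monom (c $ k) k) $ i" .
qed

text \<open>Every diagonal entry divides the last, so \<open>D\<close> has a diagonal cofactor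
  \<open>E\<close> with product d times the identity; \<open>Q * E * P\<close> then works because
  scalar matrices commute with \<open>P\<close>. Thus \<open>d\<close> annihilates the cokernel of
  \<open>A\<close>.\<close>

lemma smith_normal_form_right_quasi_inverse:
  assumes "smith_normal_form n A D" "n > 0"
  defines "d \<equiv> D $$ (n - 1, n - 1)"
  shows "d > 0" "\<exists>B \<in> carrier_mat n n. A * B = d \<cdot>\<^sub>m 1\<^sub>m n"
proof -
  obtain P Q where A: "A \<in> carrier_mat n n" and D: "D \<in> carrier_mat n n" and diag: "diagonal_mat D"
    and P: "P \<in> carrier_mat n n" "invertible_mat P" and Q: "Q \<in> carrier_mat n n" "invertible_mat Q"
    and PAQ: "D = P * A * Q" and pos: "\<And>i. i < n \<Longrightarrow> D $$ (i, i) > 0"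
    and chain: "\<And>i. Suc i < n \<Longrightarrow> D $$ (i, i) dvd D $$ (Suc i, Suc i)"
    using assms(1) unfolding smith_normal_form_def by blast
  show "d > 0" using pos[of "n - 1"] assms(2) by (simp add: d_def)
  have dvd: "D $$ (i, i) dvd d" if "i \<le> n - 1" for i
    using that
  proof (induction i rule: inc_induct)
    case (step i)
    then show ?case using chain[of i] dvd_trans by fastforce
  qed (simp add: d_def)
  define E where "E = mat n n (\<lambda>(i, j). if i = j then d div D $$ (i, i) else 0)"
  have E: "E \<in> carrier_mat n n" by (simp add: E_def)
  have DE: "D * E = d \<cdot>\<^sub>m 1\<^sub>m n"
  proof (rule eq_matI)
    fix i j assume "i < dim_row (d \<cdot>\<^sub>m 1\<^sub>m n)" "j < dim_col (d \<cdot>\<^sub>m 1\<^sub>m n)"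
    then have ij: "i < n" "j < n" by auto
    have "(D * E) $$ (i, j) = (\<Sum>k<n. D $$ (i, k) * E $$ (k, j))"
      using ij D E by (simp add: scalar_prod_def lessThan_atLeast0)
    also have "\<dots> = (\<Sum>k<n. if k = j then D $$ (i, j) * E $$ (j, j) else 0)"
      using ij by (intro sum.cong) (auto simp: E_def)
    also have "\<dots> = D $$ (i, j) * (d div D $$ (j, j))" using ij by (simp add: E_def)
    also have "\<dots> = (d \<cdot>\<^sub>m 1\<^sub>m n) $$ (i, j)"
      using ij dvd[of i] diag D by (auto simp: diagonal_mat_def)
    finally show "(D * E) $$ (i, j) = (d \<cdot>\<^sub>m 1\<^sub>m n) $$ (i, j)" .
  qed (use D E in auto)
  obtain P' where P': "P * P' = 1\<^sub>m n" "P' * P = 1\<^sub>m (dim_row P')"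
    using P unfolding invertible_mat_def inverts_mat_def by auto
  have P'c: "P' \<in> carrier_mat n n"
    using arg_cong[OF P'(1), of dim_col] arg_cong[OF P'(2), of dim_col] P(1) by auto
  have "A * (Q * E * P) = 1\<^sub>m n * A * Q * E * P"
    using A Q(1) E P(1) by (simp add: assoc_mult_mat[of _ n n _ n _ n])
  also have "1\<^sub>m n = P' * P" using P'(2) P'c by simp
  also have "P' * P * A * Q * E * P = P' * (P * A * Q * E) * P"
    using A Q(1) E P(1) P'c by (simp add: assoc_mult_mat[of _ n n _ n _ n])
  also have "P * A * Q * E = d \<cdot>\<^sub>m 1\<^sub>m n" using DE PAQ by simp
  also have "P' * (d \<cdot>\<^sub>m 1\<^sub>m n) * P = d \<cdot>\<^sub>m (P' * P)"
    using P'c P(1) by (simp add: mult_smult_distrib[of _ n n _ n] mult_smult_assoc_mat[of _ n n _ n])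
  finally have "A * (Q * E * P) = d \<cdot>\<^sub>m 1\<^sub>m n" using P'(2) P'c by simp
  moreover have "Q * E * P \<in> carrier_mat n n" using Q(1) E P(1) by simp
  ultimately show "\<exists>B \<in> carrier_mat n n. A * B = d \<cdot>\<^sub>m 1\<^sub>m n" by blast
qed

text \<open>The adjugate of the walk matrix derives independence from the nonzero determinant; the
  quasi-inverse \<open>B\<close> supplies the polynomials for \<open>gen\<close>.\<close>

lemma skew_walks_skew_adjacency:
  assumes graph: "oriented_graph G" and contr: "controllable n G"
    and B: "B \<in> carrier_mat n n" "skew_walk n G * B = d \<cdot>\<^sub>m 1\<^sub>m n"
  shows "skew_walks n (skew_adjacency n G) (all_one_vec n) d"
proof
  let ?W = "skew_walk n G"
  have W: "?W \<in> carrier_mat n n" by simp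
  fix f assume f: "mat_poly_vec (skew_adjacency n G) (all_one_vec n) f = 0\<^sub>v n" "degree f < n"
  define c where "c = vec n (coeff f)"
  have c: "c \<in> carrier_vec n" by (simp add: c_def)
  have f_sum: "f = (\<Sum>k<n. monom (c $ k) k)"
    using poly_eq_sum_monom_lessThan[of n f] f(2) by (simp add: c_def coeff_eq_0)
  then have "?W *\<^sub>v c = 0\<^sub>v n" using skew_walk_mult_vec[OF c] f(1) by metis
  then have "(adj_mat ?W * ?W) *\<^sub>v c = 0\<^sub>v n"
    using adj_mat(1)[OF W] W c by (auto simp: assoc_mult_mat_vec[of _ n n _ n])
  then have "(det ?W \<cdot>\<^sub>m 1\<^sub>m n) *\<^sub>v c = 0\<^sub>v n" by (simp only: adj_mat(3)[OF W])
  then have "det ?W \<cdot>\<^sub>v c = 0\<^sub>v n" by (simp only: smult_one_mat_mult_vec[OF c])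
  then have "(det ?W \<cdot>\<^sub>v c) $ k = 0" if "k < n" for k using that by simp
  then have "c $ k = 0" if "k < n" for k using contr that c by (auto simp: controllable_def)
  then show "f = 0" using f_sum by simp
next
  fix y :: "int vec" assume y: "y \<in> carrier_vec n"
  have "skew_walk n G *\<^sub>v (B *\<^sub>v y) = (d \<cdot>\<^sub>m 1\<^sub>m n) *\<^sub>v y"
    using B y assoc_mult_mat_vec[OF skew_walk_carrier B(1) y, of G] by simp
  also have "\<dots> = d \<cdot>\<^sub>v y" by (rule smult_one_mat_mult_vec[OF y])
  finally show "\<exists>f. mat_poly_vec (skew_adjacency n G) (all_one_vec n) f = d \<cdot>\<^sub>v y"
    using skew_walk_mult_vec[of "B *\<^sub>v y" n G] B(1) y by auto
qed (simp_all add: transpose_skew_adjacency[OF graph])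

text \<open>The products m g with deg g < n - deg m have coefficient vectors in the kernel modulo
  \<open>p\<close>; cancelling \<open>m\<close> shows that distinct reduced \<open>g\<close> give
  distinct vectors.\<close>

lemma nullity_mod_skew_walk_ge:
  assumes "skew_walks_mod n (skew_adjacency n G) (all_one_vec n) d p m h"
  shows "n - degree m \<le> nullity_mod p (skew_walk n G)"
proof -
  interpret skew_walks_mod n "skew_adjacency n G" "all_one_vec n" d p m h by (rule assms)
  define k where "k = n - degree m"
  define g where "g c = (\<Sum>j<k. monom (c j) j)" for c :: "nat \<Rightarrow> int"
  have coeff_g: "coeff (g c) i = (if i < k then c i else 0)" for c i
    by (simp add: g_def coeff_sum)
  define F where "F c = vec n (coeff (Mp (m * g c)))" for c
  \<comment> \<open>The product has degree below \<open>n\<close>, so truncation to \<open>n\<close>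
    coefficients in \<open>F\<close> loses nothing.\<close>
  have high: "coeff (Mp (m * g c)) i = 0" if "i \<ge> n" for c i
  proof (cases "g c = 0")
    case False
    have "degree (g c) < k"
    proof (rule ccontr)
      assume "\<not> ?thesis"
      then have "lead_coeff (g c) = 0" unfolding coeff_g by simp
      then show False using False by simp
    qed
    then have "degree (m * g c) < n" using degree_mult_le[of m "g c"] by (simp add: k_def)
    then show ?thesis using that degree_m_le[of "m * g c"] by (intro coeff_eq_0) simp
  qed simp
  have range: "0 \<le> coeff (Mp f) i \<and> coeff (Mp f) i < p" for f i
    using p_gt_1 by (simp add: Mp_coeff M_def)
  have g_fixed: "Mp (g c) = g c" if "c \<in> {..<k} \<rightarrow>\<^sub>E {0..<p}" for c
    unfolding Mp_fixed_iff coeff_g using that p_gt_1 by (auto simp: PiE_iff)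
  have "k \<le> nullity_mod p (skew_walk n G)"
  proof (rule nullity_mod_ge[OF prime_p skew_walk_carrier])
    show "inj_on F ({..<k} \<rightarrow>\<^sub>E {0..<p})"
    proof (rule inj_onI)
      fix c c' assume c: "c \<in> {..<k} \<rightarrow>\<^sub>E {0..<p}" "c' \<in> {..<k} \<rightarrow>\<^sub>E {0..<p}" "F c = F c'"
      have "coeff (Mp (m * g c)) i = coeff (Mp (m * g c')) i" for i
      proof (cases "i < n")
        case True
        then show ?thesis using arg_cong[OF c(3), of "\<lambda>v. v $ i"] by (simp add: F_def)
      qed (simp add: high)
      then have "m * g c =m m * g c'" by (rule poly_eqI)
      then have "g c =m g c'" using m_not_0 by (rule eq_m_cancel_left)
      then have "g c = g c'" using g_fixed c by metis
      then have "c i = c' i" if "i < k" for i using coeff_g[of c i] coeff_g[of c' i] that by simp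
      then show "c = c'" using c(1,2) by (intro PiE_ext) auto
    qed
  next
    fix c assume "c \<in> {..<k} \<rightarrow>\<^sub>E {0..<p}"
    show "F c \<in> carrier (residue_vecs p n)"
      using range by (simp add: carrier_residue_vecs_iff[OF p_gt_1] F_def)
    have "skew_walk n G *\<^sub>v F c = walk (\<Sum>k<n. monom (F c $ k) k)"
      by (rule skew_walk_mult_vec) (simp add: F_def)
    also have "(\<Sum>k<n. monom (F c $ k) k) = Mp (m * g c)"
      using poly_eq_sum_monom_lessThan[of n "Mp (m * g c)"] high by (simp add: F_def)
    finally show "p dvd (skew_walk n G *\<^sub>v F c) $ i" if "i < n" for i
      using m_iff[of "Mp (m * g c)"] that by simp
  qed
  then show ?thesis by (simp add: k_def)
qed

text \<open>Each prime occurs in \<open>d\<close> at most once, so divisibility can be checked one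
  prime at a time.\<close>

lemma squarefree_dvdI:
  fixes d a :: int
  assumes "squarefree d" "d \<noteq> 0" "\<And>p. prime p \<Longrightarrow> p dvd d \<Longrightarrow> p dvd a"
  shows "d dvd a"
proof (cases "a = 0")
  case False
  show ?thesis
  proof (rule multiplicity_le_imp_dvd[OF assms(2)])
    fix p :: int assume p: "prime p"
    show "multiplicity p d \<le> multiplicity p a"
    proof (cases "p dvd d")
      case True
      have "multiplicity p d \<le> 1"
        using assms(1,2) p by (simp add: squarefree_factorial_semiring'' prime_elem_def)
      also have "1 \<le> multiplicity p a"
        using assms(3)[OF p True] prime_gt_1_int[OF p] False by (intro multiplicity_geI) auto
      finally show ?thesis .
    qed (simp add: not_dvd_imp_multiplicity_0)
  qed
qed simp

text \<open>Entries 1 and -1 mark the two directions of an arc, so the sign change says that \<pi>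
  reverses arcs; being its own inverse, \<pi> is bijective on vertices and arcs.\<close>

lemma self_converse_if_skew_involution:
  assumes graph: "oriented_graph G" and verts: "pverts G = {0..<n}"
    and \<pi>: "\<And>j. j < n \<Longrightarrow> \<pi> j < n" "\<And>j. j < n \<Longrightarrow> \<pi> (\<pi> j) = j"
    and skew: "\<And>i j. i < n \<Longrightarrow> j < n \<Longrightarrow>
      skew_adjacency n G $$ (\<pi> i, \<pi> j) = - skew_adjacency n G $$ (i, j)"
  shows "self_converse G"
proof -
  interpret oriented_graph G by (rule graph)
  have arc_lt: "i < n \<and> j < n" if "(i, j) \<in> parcs G" for i j
    using that in_arcsD1[OF that] in_arcsD2[OF that] verts by simp
  have entry: "(i, j) \<in> parcs G \<longleftrightarrow> skew_adjacency n G $$ (i, j) = 1"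
    "(j, i) \<in> parcs G \<longleftrightarrow> skew_adjacency n G $$ (i, j) = -1" if "i < n" "j < n" for i j
    using that one_direction by (auto simp: skew_adjacency_def)
  have arc: "(\<pi> j, \<pi> i) \<in> parcs G" if "(i, j) \<in> parcs G" for i j
    using that arc_lt[OF that] entry[of i j] entry[of "\<pi> i" "\<pi> j"] skew[of i j] \<pi>(1) by simp
  have inj: "inj_on \<pi> {0..<n}" by (rule inj_on_inverseI[of _ \<pi>]) (simp add: \<pi>)
  have surj: "\<pi> ` {0..<n} = {0..<n}"
  proof (intro equalityI subsetI)
    fix j assume "j \<in> {0..<n}"
    then show "j \<in> \<pi> ` {0..<n}" using \<pi> by (intro image_eqI[of _ _ "\<pi> j"]) auto
  qed (use \<pi> in auto)
  have inj_arcs: "inj_on (map_prod \<pi> \<pi>) (parcs G)"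
    using arc_lt inj by (intro inj_onI) (auto dest!: arc_lt inj_onD[OF inj])
  have surj_arcs: "map_prod \<pi> \<pi> ` parcs G = (parcs G)\<inverse>"
  proof (intro equalityI subsetI)
    fix x assume "x \<in> map_prod \<pi> \<pi> ` parcs G"
    then show "x \<in> (parcs G)\<inverse>" using arc by auto
  next
    fix x assume "x \<in> (parcs G)\<inverse>"
    then obtain i j where x: "x = (i, j)" "(j, i) \<in> parcs G" by auto
    then have "x = map_prod \<pi> \<pi> (\<pi> i, \<pi> j)" using arc_lt \<pi>(2) by auto
    then show "x \<in> map_prod \<pi> \<pi> ` parcs G" using arc[OF x(2)] by (rule image_eqI)
  qed
  let ?f = "\<lparr>iso_verts = \<pi>, iso_arcs = map_prod \<pi> \<pi>, iso_head = snd, iso_tail = fst\<rparr>"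
  have "pre_digraph.digraph_isomorphism (with_proj G) ?f"
    unfolding pre_digraph.digraph_isomorphism_def
    using inj inj_arcs verts wf_digraph_axioms by (auto simp: with_proj_def)
  moreover have "with_proj (converse_graph G) = app_iso ?f (with_proj G)"
    using surj surj_arcs verts by (simp add: with_proj_def converse_graph_def app_iso_def)
  ultimately show ?thesis unfolding self_converse_def digraph_iso_def by blast
qed

theorem corollary6:
  fixes G :: "nat pair_pre_digraph" and n :: nat and D :: "int mat" and d :: int
  assumes graph: "oriented_graph G" and verts: "pverts G = {0..<n}"
    and controllable: "controllable n G"
    and smith: "smith_normal_form n (skew_walk n G) D" and d: "d = D $$ (n - 1, n - 1)"
    and squarefree: "squarefree d"
    and rank_2: "int (rank_mod 2 (skew_walk n G)) = \<lceil>real n / 2\<rceil>"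
    and i: "\<And>p. prime p \<Longrightarrow> odd p \<Longrightarrow> p dvd d \<Longrightarrow>
           degree (sfp_mod p (Phi_mod p n G)) = nullity_mod p (skew_walk n G)"
    and ii: "\<And>p \<phi>s i j. prime p \<Longrightarrow> odd p \<Longrightarrow> p dvd d \<Longrightarrow>
           distinct \<phi>s \<Longrightarrow> (\<forall>\<phi> \<in> set \<phi>s. monic_irreducible_mod p \<phi>) \<Longrightarrow>
           sfp_mod p (Phi_mod p n G) = poly_mod.Mp p (prod_list \<phi>s) \<Longrightarrow>
           i < length \<phi>s \<Longrightarrow> j < length \<phi>s \<Longrightarrow> i \<noteq> j \<Longrightarrow>
           gcd_mod p (\<phi>s ! i) (pcompose (\<phi>s ! j) [:0, -1:]) = 1"
  shows "self_converse G"
proof (cases "n = 0")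
  \<comment> \<open>The index n - 1 names the last diagonal entry only for n > 0, so the empty graph
    is treated apart.\<close>
  case True
  then show ?thesis
    using self_converse_if_skew_involution[OF graph verts, of id] by simp
next
  case False
  have d_pos: "d > 0" using smith_normal_form_right_quasi_inverse(1)[OF smith] False d by simp
  then have d_nz: "d \<noteq> 0" by simp
  obtain B where B: "B \<in> carrier_mat n n" "skew_walk n G * B = d \<cdot>\<^sub>m 1\<^sub>m n"
    using smith_normal_form_right_quasi_inverse(2)[OF smith] False d by auto
  let ?S = "skew_adjacency n G"
  interpret skew_walks n ?S "all_one_vec n" d
    by (rule skew_walks_skew_adjacency[OF graph controllable B])
  have prime_step: "p dvd walk (reflect_arg f) $ k"
    if p: "prime p" "p dvd d" and f: "\<And>k. k < n \<Longrightarrow> d dvd walk f $ k" and k: "k < n" for p f k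
  proof (cases "odd p")
    case False
    then have p2: "p = 2" using primes_dvd_imp_eq[of 2 p] p(1) by simp
    \<comment> \<open>The coefficients of f(-x) and f(x) differ at most in sign, so reflection is
      trivial modulo 2.\<close>
    have "[:2:] dvd reflect_arg f - f"
      unfolding const_poly_dvd_iff by (simp add: coeff_reflect_arg minus_one_power_iff)
    then have "2 dvd walk (reflect_arg f - f) $ k" by (rule mat_poly_vec_dvd[OF S e _ k])
    moreover have "2 dvd walk f $ k" using f[OF k] p(2) p2 dvd_trans by blast
    moreover have "walk (reflect_arg f) = walk (reflect_arg f - f) + walk f"
      by (simp flip: mat_poly_vec_add[OF S e])
    ultimately show ?thesis using k carrier_vecD[OF walk_carrier] p2 by simp
  next
    case True
    obtain m h where "skew_walks_mod n ?S (all_one_vec n) d p m h"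
      using minimal_polynomial_mod[OF p] by blast
    then interpret skew_walks_mod n ?S "all_one_vec n" d p m h .
    have chi: "monic (char_poly ?S)" using degree_monic_char_poly[OF S] by auto
    have chi_nz: "\<not> char_poly ?S =m 0"
      unfolding eq_m_0_iff_dvd by (rule monic_not_const_p_dvd[OF chi])
    define \<Phi> where "\<Phi> = Phi_mod p n G"
    \<comment> \<open>By the rank-one formula the common factors of the two characteristic
      polynomials are those of \<chi> and its Bezoutian.\<close>
    have Phi_eq: "\<Phi> = gcd_mod p (char_poly ?S) (char_poly ?S - bezoutian (char_poly ?S))"
      unfolding \<Phi>_def Phi_mod_def char_poly_add_all_one[OF S] ..
    note gcd = gcd_mod_spec[OF chi_nz, where g = "char_poly ?S - bezoutian (char_poly ?S)", folded Phi_eq]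
    define F where "F = {q. monic_irreducible_mod p q \<and> q dvdm \<Phi>}"
    note sfp = sfp_mod_spec[OF gcd(1), folded F_def]
    have dvd_Phi: "q dvdm \<Phi> \<longleftrightarrow> q dvdm char_poly ?S \<and> q dvdm bezoutian (char_poly ?S)" for q
    proof
      assume "q dvdm \<Phi>"
      then have 1: "q dvdm char_poly ?S" and 2: "q dvdm char_poly ?S - bezoutian (char_poly ?S)"
        using gcd(2,3) dvdm_trans by blast+
      then show "q dvdm char_poly ?S \<and> q dvdm bezoutian (char_poly ?S)" using dvdm_diff[OF 1 2] by simp
    next
      assume "q dvdm char_poly ?S \<and> q dvdm bezoutian (char_poly ?S)"
      then show "q dvdm \<Phi>" by (elim conjE) (rule gcd(4)[OF _ dvdm_diff])
    qed
    \<comment> \<open>Hypothesis (ii) is stated for lists of factors; any enumeration of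
      \<open>F\<close> serves.\<close>
    obtain \<phi>s where \<phi>s: "set \<phi>s = F" "distinct \<phi>s" using finite_distinct_list[OF sfp(1)] by blast
    have coprime: "gcd_mod p q (reflect_arg q') = 1" if qq': "q \<in> F" "q' \<in> F" "q \<noteq> q'" for q q'
    proof -
      obtain i j where ij: "i < length \<phi>s" "j < length \<phi>s" "\<phi>s ! i = q" "\<phi>s ! j = q'"
        using qq'(1,2) \<phi>s(1) by (metis in_set_conv_nth)
      have "\<Prod>F = prod_list \<phi>s" using prod.distinct_set_conv_list[OF \<phi>s(2), of "\<lambda>q. q"] \<phi>s(1) by simp
      then show ?thesis
        using ii[OF p(1) True p(2) \<phi>s(2), of i j] sfp(2) \<phi>s(1) ij qq'(3) by (auto simp: F_def \<Phi>_def)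
    qed
    have F_alt: "F = {q. monic_irreducible_mod p q \<and> q dvdm char_poly ?S \<and> q dvdm bezoutian (char_poly ?S)}"
      by (simp add: F_def dvd_Phi)
    have "\<not> p * p dvd d"
      using squarefree p(1) by (metis power2_eq_square squarefreeD not_prime_unit)
    then have "m dvdm reflect_arg m"
    proof (rule m_dvdm_reflect_arg[OF _ sfp(1)])
      show "q dvdm reflect_arg q" if "q \<in> F" for q
        using common_factor_symmetric coprime that unfolding F_alt by blast
      have "monic (\<Prod>F)" by (intro monic_prod) (auto simp: F_def monic_irreducible_mod_def monic_mod_def)
      \<comment> \<open>Hypothesis (i) equates this degree with the nullity, which the multiples of
        \<open>m\<close> bound from below.\<close>
      then have "degree (\<Prod>F) = nullity_mod p (skew_walk n G)"
        using monic_mod_Mp(2) i[OF p(1) True p(2)] sfp(2) \<Phi>_def by simp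
      then show "n - degree m \<le> degree (\<Prod>F)"
        using nullity_mod_skew_walk_ge[OF skew_walks_mod_axioms] by simp
    qed (auto simp: F_alt)
    \<comment> \<open>As \<open>d\<close> divides the walk of \<open>f\<close>, so does
      \<open>p\<close>, and \<open>m\<close> divides \<open>f\<close>; the symmetry of
      \<open>m\<close> carries this over to f(-x).\<close>
    moreover have "m dvdm f" unfolding m_iff[symmetric] using f p(2) dvd_trans by blast
    ultimately have "m dvdm reflect_arg f" using reflect_arg_dvdm dvdm_trans by blast
    then show ?thesis using m_iff k by blast
  qed
  have dvd: "d dvd walk (reflect_arg f) $ k"
    if f: "\<And>k. k < n \<Longrightarrow> d dvd walk f $ k" and k: "k < n" for f k
    by (rule squarefree_dvdI[OF squarefree d_nz]) (rule prime_step[OF _ _ f k])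
  obtain \<pi> where "\<And>j. j < n \<Longrightarrow> \<pi> j < n" "\<And>j. j < n \<Longrightarrow> \<pi> (\<pi> j) = j"
    "\<And>i j. i < n \<Longrightarrow> j < n \<Longrightarrow> ?S $$ (\<pi> i, \<pi> j) = - ?S $$ (i, j)"
    using skew_involution[OF d_nz refl dvd] by blast
  then show ?thesis by (rule self_converse_if_skew_involution[OF graph verts])
qed

end
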